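(* Let $A$ be a real $m\times n$ payoff matrix such that the value of the one-shot matrix game $A$ cannot be obtained by a pure action of Player 2, and let $S$ be an $n\times n$ switching-cost matrix all of whose off-diagonal entries are strictly positive. Let $v$, $\bar v$, $y^*$, $\underline c$ and $\bar c$ be as defined in the context, let $s={y^*}^TSy^*$ and $c_0=\frac{\bar v-v}{s}$. Then Player 2's loss from limiting himself to static strategies in the game $(A,S,c)$, namely $\tilde v(c)-v(c)$, is bounded by $$\Delta(c)=\begin{cases}(c-\underline c)\,\dfrac{\bar c-c_0}{\bar c-\underline c}\,s & \text{if } c\in(\underline c,c_0],\\[2mm] (\bar c-c)\,\dfrac{c_0-\underline c}{\bar c-\underline c}\,s & \text{if } c\in(c_0,\bar c),\\[2mm] 0 & \text{otherwise.}\end{cases}$$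
   Context: A zero-sum game with switching costs is a tuple $(A,S,c)$ where $A=(a_{ij})$ is a real $m\times n$ matrix, normalized without loss of generality so that its minimal and maximal entries are $0$ and $1$, $c\ge 0$, and $S=(s_{kj})$ is an $n\times n$ matrix (the switching-cost matrix) with $s_{kj}\ge 0$ and $s_{jj}=0$ for all $k,j$, normalized so that its smallest nonzero entry is $1$. At each stage $t=1,2,\dots$, Player 1 (the maximizer) chooses a row $i(t)$ and Player 2 (the minimizer) chooses a column $j(t)$, possibly at random, knowing the history of realized actions. The stage payoff, paid by Player 2 to Player 1, is $u_t=a_{i(t)j(t)}+c\,s_{j(t-1)j(t)}$, with no switching cost paid at $t=1$. For a strategy pair $(\sigma,\tau)$ the payoff is $\gamma(\sigma,\tau)=\mathbb{E}_{\sigma,\tau}\big(\liminf_{T\to\infty}\frac1T\sum_{t=1}^T u_t\big)$. A stationary strategy is one in which the mixed action at stage $t$ depends only on the previous action $j(t-1)$ of Player 2, and not on the rest of the history or on $t$. The game has a value, denoted $v(c)$, attained in stationary strategies. A static strategy plays the same mixed action at every stage regardless of the history. The minimax value in static strategies is $\tilde v(c)=\min_{y\in\Delta(\{1,\dots,n\})}\max_{x\in\Delta(\{1,\dots,m\})}\{x^TAy+c\,y^TSy\}$. Further notation: $v=\min_y\max_x x^TAy$ is the (mixed) value of the one-shot game $A$, and $\bar v=\min_j\max_i a_{ij}$ is its minimax value in pure actions. $\mathcal A$ is the set of optimal mixed actions of Player 2 in the one-shot game $A$, and $y^*\in\operatorname{argmin}_{y\in\mathcal A}y^TSy$. $\underline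 c$ is the maximal number such that $v(c)=\tilde v(c)$ for every $c\in[0,\underline c]$, i.e. such that on this interval the value is attained by some static strategy. $\bar c$ is the threshold such that Player 2's optimal strategy is the pure minimax strategy of the matrix game $A$ for every $c\ge\bar c$, but not for $c<\bar c$ (it exists because all off-diagonal entries of $S$ are positive); hence $v(c)=\tilde v(c)=\bar v$ for $c\ge\bar c$.
   Formalization: The threshold c̲ is taken as the largest number such that v(c)=ṽ(c) on [0,c̲] and one and the same static strategy is optimal on all of [0,c̲]; if the static strategy may vary with c, a maximal number may not exist and the stated bound can fail. *)

theory Defs
  imports "HOL-Probability.Probability"
begin

text \<open>
  The two finite action sets are the types \<open>'m\<close> (rows, Player 1, the maximizer) and \<open>'n\<close>
  (columns, Player 2, the minimizer), so that \<^typ>\<open>'m pmf\<close> and \<^typ>\<open>'n pmf\<close> are the simplices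
  of mixed actions.
\<close>

text \<open>The number \<open>x\<^sup>T M y\<close>.\<close>

definition bilin :: "real^'b^'a \<Rightarrow> 'a::finite pmf \<Rightarrow> 'b::finite pmf \<Rightarrow> real" where
  "bilin M x y = (\<Sum>i\<in>UNIV. \<Sum>j\<in>UNIV. pmf x i * M $ i $ j * pmf y j)"

text \<open>
  In \<open>S\<close> the first index is the previous action of Player 2 and the second index the current one.
  The entries of \<open>A\<close> have minimum 0 and maximum 1, and the smallest nonzero entry of \<open>S\<close> is 1.
\<close>

definition switching_game :: "real^'n^'m \<Rightarrow> real^'n^'n \<Rightarrow> real \<Rightarrow> bool" where
  "switching_game A S c \<longleftrightarrow>
     (\<forall>i j. 0 \<le> A $ i $ j \<and> A $ i $ j \<le> 1) \<and> (\<exists>i j. A $ i $ j = 0) \<and> (\<exists>i j. A $ i $ j = 1) \<and>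
     0 \<le> c \<and>
     (\<forall>k j. 0 \<le> S $ k $ j) \<and> (\<forall>j. S $ j $ j = 0) \<and>
     (\<forall>k j. S $ k $ j \<noteq> 0 \<longrightarrow> 1 \<le> S $ k $ j) \<and> (\<exists>k j. S $ k $ j = 1)"


subsection \<open>The repeated game\<close>

text \<open>
  A history lists the realized action pairs in chronological order; a (behavioral) strategy maps
  histories to mixed actions. A play is a map \<^typ>\<open>nat \<Rightarrow> 'm \<times> 'n\<close>, whose value at \<open>t\<close> is the
  action pair at stage \<open>t + 1\<close>.
\<close>

type_synonym ('m, 'n) history = "('m \<times> 'n) list"
type_synonym ('m, 'n) strategy1 = "('m, 'n) history \<Rightarrow> 'm pmf"
type_synonym ('m, 'n) strategy2 = "('m, 'n) history \<Rightarrow> 'n pmf"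

definition stage_kernel ::
  "('m, 'n) strategy1 \<Rightarrow> ('m, 'n) strategy2 \<Rightarrow> nat \<Rightarrow> (nat \<Rightarrow> 'm \<times> 'n) \<Rightarrow> ('m \<times> 'n) measure" where
  "stage_kernel \<sigma> \<tau> t \<omega> =
     measure_pmf (pair_pmf (\<sigma> (map \<omega> [0..<t])) (\<tau> (map \<omega> [0..<t])))"

text \<open>
  The law of the play is the Ionescu-Tulcea limit of these kernels. The lemmas \<open>stage_kernel\<close> and
  \<open>emeasure_play_prefix\<close> below show that the locale applies and that finite histories have the
  expected probabilities.
\<close>

definition play_measure ::
  "('m, 'n) strategy1 \<Rightarrow> ('m, 'n) strategy2 \<Rightarrow> (nat \<Rightarrow> 'm \<times> 'n) measure" where
  "play_measure \<sigma> \<tau> =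
     projective_family.lim UNIV (Ionescu_Tulcea.CI (stage_kernel \<sigma> \<tau>) (\<lambda>_. count_space UNIV))
       (\<lambda>_. count_space UNIV)"

lemma stage_kernel:
  fixes \<sigma> :: "('m::finite, 'n::finite) strategy1" and \<tau> :: "('m, 'n) strategy2"
  shows "Ionescu_Tulcea (stage_kernel \<sigma> \<tau>) (\<lambda>_. count_space UNIV)"
proof (rule Ionescu_Tulcea.intro)
  fix t
  have "stage_kernel \<sigma> \<tau> t \<in> measurable (count_space ({0..<t} \<rightarrow>\<^sub>E UNIV))
          (subprob_algebra (count_space UNIV))"
    by (auto simp: stage_kernel_def space_subprob_algebra measure_pmf.subprob_space_axioms)
  then show "stage_kernel \<sigma> \<tau> t \<in> measurable (PiM {0..<t} (\<lambda>_. count_space UNIV))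
          (subprob_algebra (count_space UNIV))"
    by (simp add: count_space_PiM_finite countable_finite)
next
  fix t \<omega>
  show "prob_space (stage_kernel \<sigma> \<tau> t \<omega>)"
    by (simp add: stage_kernel_def measure_pmf.prob_space_axioms)
qed

lemma prob_space_play_measure:
  fixes \<sigma> :: "('m::finite, 'n::finite) strategy1" and \<tau> :: "('m, 'n) strategy2"
  shows "prob_space (play_measure \<sigma> \<tau>)"
proof -
  interpret Ionescu_Tulcea "stage_kernel \<sigma> \<tau>" "\<lambda>_. count_space UNIV"
    by (rule stage_kernel)
  have e: "PF.emb UNIV {} {\<lambda>_. undefined} = space (play_measure \<sigma> \<tau>)"
    by (auto simp: play_measure_def prod_emb_def space_PiM)
  have "emeasure (CI {}) {\<lambda>_. undefined} = 1"
    using prob_space.emeasure_space_1[OF PF.prob_space_P[of "{}"]]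
    by (simp add: PF.space_P space_PiM)
  then show ?thesis
    using lim[of "{}" "{\<lambda>_. undefined}"] e
    by (intro prob_spaceI) (simp add: play_measure_def PiM_empty)
qed

lemma emeasure_play_prefix:
  fixes \<sigma> :: "('m::finite, 'n::finite) strategy1" and \<tau> :: "('m, 'n) strategy2"
    and f :: "nat \<Rightarrow> 'm \<times> 'n"
  shows "emeasure (play_measure \<sigma> \<tau>) {\<omega>. \<forall>t<n. \<omega> t = f t} =
    (\<Prod>t<n. ennreal (pmf (\<sigma> (map f [0..<t])) (fst (f t)) * pmf (\<tau> (map f [0..<t])) (snd (f t))))"
    (is "_ = (\<Prod>t<n. ?p t)")
proof -
  let ?M = "\<lambda>_::nat. count_space (UNIV :: ('m \<times> 'n) set)"
  interpret Ionescu_Tulcea "stage_kernel \<sigma> \<tau>" ?M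
    by (rule stage_kernel)
  let ?r = "\<lambda>k. restrict f {0..<k}"
  have sets: "sets (PiM {0..<k} ?M) = Pow ({0..<k} \<rightarrow>\<^sub>E UNIV)" for k
    by (simp add: count_space_PiM_finite countable_finite)
  have C: "emeasure (C 0 k (\<lambda>_. undefined)) {?r k} = (\<Prod>t<k. ?p t)" for k
  proof (induction k)
    case 0
    show ?case
      using sets[of 0] by (simp add: restrict_def emeasure_return PiM_empty)
  next
    case (Suc k)
    have spC: "space (C 0 k (\<lambda>_. undefined)) = {0..<k} \<rightarrow>\<^sub>E UNIV"
      by (subst space_C) (simp_all add: space_PiM)
    have eP: "emeasure (eP k \<omega>) {?r (Suc k)} = ?p k * indicator {?r k} \<omega>"
      if \<omega>: "\<omega> \<in> {0..<k} \<rightarrow>\<^sub>E UNIV" for \<omega>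
    proof -
      have "emeasure (eP k \<omega>) {?r (Suc k)} =
          emeasure (stage_kernel \<sigma> \<tau> k \<omega>) ((\<lambda>x. fun_upd \<omega> k x) -` {?r (Suc k)})"
        using \<omega> by (subst emeasure_eP) (auto simp: sets space_PiM)
      moreover have "(\<lambda>x. fun_upd \<omega> k x) -` {?r (Suc k)} = (if \<omega> = ?r k then {f k} else {})"
      proof -
        have "fun_upd \<omega> k x = ?r (Suc k) \<longleftrightarrow> \<omega> = ?r k \<and> x = f k" for x
        proof
          assume *: "fun_upd \<omega> k x = ?r (Suc k)"
          have "\<omega> t = ?r k t" for t
            using fun_cong[OF *, of t] \<omega>
            by (cases "t = k") (auto simp: PiE_iff extensional_def restrict_def split: if_splits)
          then show "\<omega> = ?r k \<and> x = f k"
            using fun_cong[OF *, of k] by auto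
        qed (auto simp: fun_eq_iff restrict_def)
        then show ?thesis
          unfolding vimage_def singleton_iff by (simp add: Collect_conv_if split: if_splits del: restrict_upd)
      qed
      moreover have "map (?r k) [0..<k] = map f [0..<k]"
        by simp
      ultimately show ?thesis
        by (auto simp: stage_kernel_def emeasure_pmf_single pmf_pair[of _ _ "fst (f k)" "snd (f k)", simplified]
            split: split_indicator simp del: map_eq_conv)
    qed
    have "emeasure (C 0 (Suc k) (\<lambda>_. undefined)) {?r (Suc k)} =
        (\<integral>\<^sup>+\<omega>. emeasure (eP k \<omega>) {?r (Suc k)} \<partial>C 0 k (\<lambda>_. undefined))"
      by (simp, subst emeasure_bind[where N = "PiM {0..<Suc k} ?M"])
         (auto simp: spC sets measurable_cong_sets[OF sets_C refl])
    also have "\<dots> = (\<integral>\<^sup>+\<omega>. ?p k * indicator {?r k} \<omega> \<partial>C 0 k (\<lambda>_. undefined))"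
      by (intro nn_integral_cong eP) (simp add: spC)
    also have "\<dots> = ?p k * emeasure (C 0 k (\<lambda>_. undefined)) {?r k}"
      by (subst nn_integral_cmult_indicator) (auto simp: sets_C sets)
    finally show ?case
      by (simp only: Suc.IH prod.lessThan_Suc mult.commute)
  qed
  have emb: "{\<omega>. \<forall>t<n. \<omega> t = f t} = PF.emb UNIV {0..<n} {?r n}"
    by (auto simp: prod_emb_def space_PiM fun_eq_iff restrict_def split: if_splits)
  have "emeasure (CI {0..<n}) {?r n} = emeasure (C 0 n (\<lambda>_. undefined)) (PF.emb {0..<n} {0..<n} {?r n})"
    by (intro emeasure_CI) (auto simp: sets)
  also have "PF.emb {0..<n} {0..<n} {?r n} = {?r n}"
    by (auto simp: prod_emb_def space_PiM)
  finally have CI: "emeasure (CI {0..<n}) {?r n} = (\<Prod>t<n. ?p t)"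
    by (simp only: C)
  have "emeasure PF.lim (PF.emb UNIV {0..<n} {?r n}) = emeasure (CI {0..<n}) {?r n}"
    by (intro lim) (auto simp: sets)
  then show ?thesis
    unfolding emb play_measure_def CI .
qed

definition stage_payoff :: "real^'n^'m \<Rightarrow> real^'n^'n \<Rightarrow> real \<Rightarrow> (nat \<Rightarrow> 'm \<times> 'n) \<Rightarrow> nat \<Rightarrow> real" where
  "stage_payoff A S c \<omega> t =
     A $ fst (\<omega> t) $ snd (\<omega> t) +
     (if t = 0 then 0 else c * S $ snd (\<omega> (t - 1)) $ snd (\<omega> t))"

text \<open>
  The limit inferior is taken in the extended reals; the averages are bounded, so it is finite.
\<close>

definition payoff ::
  "real^'n^'m \<Rightarrow> real^'n^'n \<Rightarrow> real \<Rightarrow> ('m, 'n) strategy1 \<Rightarrow> ('m, 'n) strategy2 \<Rightarrow> real" where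
  "payoff A S c \<sigma> \<tau> =
     (LINT \<omega>|play_measure \<sigma> \<tau>.
        real_of_ereal (liminf (\<lambda>T. ereal ((\<Sum>t<T. stage_payoff A S c \<omega> t) / real T))))"

definition is_game_value :: "real^'n^'m \<Rightarrow> real^'n^'n \<Rightarrow> real \<Rightarrow> real \<Rightarrow> bool" where
  "is_game_value A S c w \<longleftrightarrow>
     (SUP \<sigma>. INF \<tau>. payoff A S c \<sigma> \<tau>) = w \<and> (INF \<tau>. SUP \<sigma>. payoff A S c \<sigma> \<tau>) = w"

definition game_value :: "real^'n^'m \<Rightarrow> real^'n^'n \<Rightarrow> real \<Rightarrow> real" where
  "game_value A S c = (THE w. is_game_value A S c w)"

definition optimal2 :: "real^'n^'m \<Rightarrow> real^'n^'n \<Rightarrow> real \<Rightarrow> ('m, 'n) strategy2 \<Rightarrow> bool" where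
  "optimal2 A S c \<tau> \<longleftrightarrow> (\<forall>\<sigma>. payoff A S c \<sigma> \<tau> \<le> game_value A S c)"

definition static_strategy :: "'n pmf \<Rightarrow> ('m, 'n) strategy2" where
  "static_strategy y = (\<lambda>_. y)"


subsection \<open>One-shot and static values\<close>

text \<open>
  Here and below, \<open>INF\<close> and \<open>SUP\<close> over mixed actions stand for the minimum over \<open>y\<close> and the
  maximum over \<open>x\<close>, which are attained.
\<close>

definition one_shot_value :: "real^'n^'m \<Rightarrow> real" where
  "one_shot_value A = (INF y. SUP x. bilin A x y)"

definition pure_minimax :: "real^'n^'m \<Rightarrow> real" where
  "pure_minimax A = (MIN j. MAX i. A $ i $ j)"

definition optimal_mixed :: "real^'n^'m \<Rightarrow> 'n pmf set" where
  "optimal_mixed A = {y. (SUP x. bilin A x y) = one_shot_value A}"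

definition static_value :: "real^'n^'m \<Rightarrow> real^'n^'n \<Rightarrow> real \<Rightarrow> real" where
  "static_value A S c = (INF y. SUP x. bilin A x y + c * bilin S y y)"


subsection \<open>The two thresholds and the bound\<close>

text \<open>
  \<open>c_lower\<close> is the largest \<open>d\<close> such that the value equals the static value on \<open>[0, d]\<close>, being
  attained on this interval by some static strategy. The static strategy is one and the same on the
  whole interval. If it were allowed to vary with \<open>c\<close>, a largest \<open>d\<close> would not always exist (for
  matching pennies with symmetric costs the two values agree for all \<open>c\<close>), and the bound below could
  fail: take \<open>A = diag(1/2, 1/2, 1/2, 1)\<close>, the rows \<open>(0,1,2,2)\<close>, \<open>(2,0,1,2)\<close>, \<open>(1,2,0,2)\<close>,
  \<open>(2,2,2,0)\<close> of \<open>S\<close>, and \<open>c = 1/3\<close>.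
\<close>

definition c_lower :: "real^'n^'m \<Rightarrow> real^'n^'n \<Rightarrow> real" where
  "c_lower A S =
     Sup {d. 0 \<le> d \<and>
       (\<exists>y. \<forall>c\<in>{0..d}. game_value A S c = static_value A S c \<and>
                         optimal2 A S c (static_strategy y))}"

definition c_upper :: "real^'n^'m \<Rightarrow> real^'n^'n \<Rightarrow> real" where
  "c_upper A S =
     Inf {d. 0 \<le> d \<and>
       (\<forall>c\<ge>d. \<exists>j. (MAX i. A $ i $ j) = pure_minimax A \<and>
                    optimal2 A S c (static_strategy (return_pmf j)))}"

definition loss_bound :: "real \<Rightarrow> real \<Rightarrow> real \<Rightarrow> real \<Rightarrow> real \<Rightarrow> real" where
  "loss_bound cl cu c0 s c =
     (if c \<in> {cl<..c0} then (c - cl) * ((cu - c0) / (cu - cl)) * s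
      else if c \<in> {c0<..<cu} then (cu - c) * ((c0 - cl) / (cu - cl)) * s
      else 0)"

end

theory Submission
  imports Defs
begin

text \<open>
  Let \<open>v\<close> be the one-shot value and \<open>s = y\<^sup>T S y\<close> the expected switching cost per stage of the static
  strategy \<open>y\<close>. As a function of \<open>c\<close>, the value of the game is concave. The static value lies below two lines: the
  static use of \<open>y\<close> gives \<open>v + c s\<close>, and a pure minimax action gives a constant, which by the choice
  of \<open>c\<^sub>0\<close> equals \<open>v + c\<^sub>0 s\<close>. Up to the lower threshold the value itself lies above the first line
  (\<open>c_lower_properties\<close>), and from the upper threshold on it lies above the second one
  (\<open>c_upper_properties\<close>). Between the thresholds concavity puts the value above the chord, and
  the asserted bound is the gap between the two lines and this chord (\<open>loss_bound_chord\<close>).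

  Concavity cannot be read off the definition of the value as an iterated supremum and infimum of
  long-run payoffs, and neither can existence. Both come from linear programming. Player 1 secures \<open>W\<close>
  if he has replies \<open>x k\<close> to the previous action \<open>k\<close> of Player 2 and a potential \<open>\<phi>\<close> such that against
  every action \<open>j\<close> the expected stage payoff plus the increase \<open>\<phi> j - \<phi> k\<close> is at least \<open>W\<close>; the predicate
  \<open>certified\<close> expresses this. If there is no such pair, a separating hyperplane is a circulation
  on Player 2's actions, that is, a stationary strategy with an invariant initial distribution,
  which holds the payoff down to \<open>W\<close> (\<open>stationary_if_not_certified\<close>). So the value exists and is the
  supremum of the certified levels (\<open>game_value_properties\<close>). Certificates for different costs can be
  averaged, whence \<open>game_value_concave\<close>.

  The payoff is the expectation of a limit inferior, and the two guarantees need different limit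
  arguments. For Player 2, Fatou's lemma is enough (\<open>payoff_le_mean\<close>). For Player 1 the averages have
  to be controlled almost surely, which is done by a law of large numbers for payoffs with conditional
  drift, proved with exponential moments (\<open>AE_running_sum_le\<close>, \<open>payoff_ge_potential\<close>).
\<close>

section \<open>The law of finite histories\<close>

abbreviation past :: "(nat \<Rightarrow> 'a) \<Rightarrow> nat \<Rightarrow> 'a list" where
  "past \<omega> n \<equiv> map \<omega> [0..<n]"

fun history_pmf :: "('m, 'n) strategy1 \<Rightarrow> ('m, 'n) strategy2 \<Rightarrow> nat \<Rightarrow> ('m, 'n) history pmf" where
  "history_pmf \<sigma> \<tau> 0 = return_pmf []"
| "history_pmf \<sigma> \<tau> (Suc n) =
     bind_pmf (history_pmf \<sigma> \<tau> n) (\<lambda>h. map_pmf (\<lambda>a. h @ [a]) (pair_pmf (\<sigma> h) (\<tau> h)))"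

lemma length_history_pmf: "h \<in> set_pmf (history_pmf \<sigma> \<tau> n) \<Longrightarrow> length h = n"
  by (induction n arbitrary: h) auto

lemma finite_set_history_pmf:
  fixes \<sigma> :: "('m::finite, 'n::finite) strategy1"
  shows "finite (set_pmf (history_pmf \<sigma> \<tau> n))"
proof (rule finite_subset)
  show "set_pmf (history_pmf \<sigma> \<tau> n) \<subseteq> {h. set h \<subseteq> UNIV \<and> length h = n}"
    by (auto dest: length_history_pmf)
qed (rule finite_lists_length_eq, rule finite)

lemma pmf_history_snoc:
  "pmf (history_pmf \<sigma> \<tau> (Suc n)) (h @ [(i, j)]) = pmf (history_pmf \<sigma> \<tau> n) h * (pmf (\<sigma> h) i * pmf (\<tau> h) j)"
proof -
  have 1: "pmf (map_pmf (\<lambda>a. h' @ [a]) (pair_pmf (\<sigma> h') (\<tau> h'))) (h @ [(i, j)]) =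
      (if h' = h then pmf (\<sigma> h) i * pmf (\<tau> h) j else 0)" for h'
  proof (cases "h' = h")
    case True
    have "pmf (map_pmf (\<lambda>a. h @ [a]) (pair_pmf (\<sigma> h) (\<tau> h))) ((\<lambda>a. h @ [a]) (i, j)) =
       pmf (pair_pmf (\<sigma> h) (\<tau> h)) (i,j)"
      by (rule pmf_map_inj') (auto simp: inj_on_def)
    then show ?thesis using True by (simp add: pmf_pair)
  next
    case False
    then have "h @ [(i, j)] \<notin> set_pmf (map_pmf (\<lambda>a. h' @ [a]) (pair_pmf (\<sigma> h') (\<tau> h')))" by auto
    then show ?thesis using False by (simp add: set_pmf_eq)
  qed
  have "pmf (history_pmf \<sigma> \<tau> (Suc n)) (h @ [(i, j)]) =
     measure_pmf.expectation (history_pmf \<sigma> \<tau> n) (\<lambda>h'. if h' = h then pmf (\<sigma> h) i * pmf (\<tau> h) j else 0)"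
    by (simp add: pmf_bind 1)
  also have "\<dots> = pmf (history_pmf \<sigma> \<tau> n) h * (pmf (\<sigma> h) i * pmf (\<tau> h) j)"
    by (subst integral_measure_pmf_real[of "{h}"]) (auto split: if_splits)
  finally show ?thesis .
qed

lemma pmf_history:
  "pmf (history_pmf \<sigma> \<tau> n) (past f n) =
    (\<Prod>t<n. pmf (\<sigma> (past f t)) (fst (f t)) * pmf (\<tau> (past f t)) (snd (f t)))"
proof (induction n)
  case (Suc n)
  show ?case
    using pmf_history_snoc[of \<sigma> \<tau> n "past f n" "fst (f n)" "snd (f n)"] by (simp add: Suc)
qed simp

lemma sets_play_measure:
  "sets (play_measure \<sigma> \<tau>) = sets (PiM UNIV (\<lambda>_. count_space UNIV))"
  for \<sigma> :: "('m::finite, 'n::finite) strategy1"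
proof -
  interpret Ionescu_Tulcea "stage_kernel \<sigma> \<tau>" "\<lambda>_. count_space UNIV"
    by (rule stage_kernel)
  show ?thesis by (simp add: play_measure_def)
qed

lemma space_play_measure [simp]: "space (play_measure \<sigma> \<tau>) = UNIV"
  for \<sigma> :: "('m::finite, 'n::finite) strategy1"
  using sets_eq_imp_space_eq[OF sets_play_measure[of \<sigma> \<tau>]] by (simp add: space_PiM)

lemma measurable_past:
  fixes \<sigma> :: "('m::finite, 'n::finite) strategy1"
  shows "(\<lambda>\<omega>. past \<omega> n) \<in> measurable (play_measure \<sigma> \<tau>) (count_space UNIV)"
proof (subst measurable_count_space_eq2_countable, intro conjI ballI)
  fix h :: "('m \<times> 'n) list"
  show "(\<lambda>\<omega>. past \<omega> n) -` {h} \<inter> space (play_measure \<sigma> \<tau>) \<in> sets (play_measure \<sigma> \<tau>)"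
  proof (cases "length h = n")
    case True
    then have "past \<omega> n = h \<longleftrightarrow> (\<forall>t<n. \<omega> t = h ! t)" for \<omega>
      by (simp add: list_eq_iff_nth_eq)
    then have eq: "(\<lambda>\<omega>. past \<omega> n) -` {h} \<inter> space (play_measure \<sigma> \<tau>) =
        {\<omega> \<in> space (play_measure \<sigma> \<tau>). \<forall>t\<in>{..<n}. \<omega> t \<in> {h ! t}}"
      by blast
    have "(\<lambda>\<omega>. \<omega> t) \<in> measurable (play_measure \<sigma> \<tau>) (count_space UNIV)" for t
      unfolding measurable_cong_sets[OF sets_play_measure refl] by (rule measurable_component_singleton) simp
    then have "{\<omega> \<in> space (play_measure \<sigma> \<tau>). \<omega> t \<in> {h ! t}} \<in> sets (play_measure \<sigma> \<tau>)" for t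
      by (rule measurable_sets_Collect) simp
    then show ?thesis unfolding eq by (intro sets.sets_Collect_finite_All) auto
  next
    case False
    then have "(\<lambda>\<omega>. past \<omega> n) -` {h} = {}" by auto
    then show ?thesis by simp
  qed
qed simp

text \<open>
  Every later expectation is computed here: on functions of a finite history, the infinite play
  measure is a finitely supported distribution that satisfies a one-step recursion.
\<close>

lemma distr_past:
  fixes \<sigma> :: "('m::finite, 'n::finite) strategy1"
  shows "distr (play_measure \<sigma> \<tau>) (count_space UNIV) (\<lambda>\<omega>. past \<omega> n) = history_pmf \<sigma> \<tau> n"
proof (rule measure_eqI_countable[where A = UNIV])
  fix h :: "('m \<times> 'n) list"
  let ?D = "distr (play_measure \<sigma> \<tau>) (count_space UNIV) (\<lambda>\<omega>. past \<omega> n)"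
  have e: "emeasure ?D {h} = emeasure (play_measure \<sigma> \<tau>) ((\<lambda>\<omega>. past \<omega> n) -` {h})"
    by (subst emeasure_distr) (auto simp: measurable_past)
  show "emeasure ?D {h} = emeasure (history_pmf \<sigma> \<tau> n) {h}"
  proof (cases "length h = n")
    case True
    then have h: "past (\<lambda>t. h ! t) n = h" using map_nth[of h] by simp
    have "past \<omega> n = h \<longleftrightarrow> (\<forall>t<n. \<omega> t = h ! t)" for \<omega>
      using True by (simp add: list_eq_iff_nth_eq)
    then have "(\<lambda>\<omega>. past \<omega> n) -` {h} = {\<omega>. \<forall>t<n. \<omega> t = h ! t}"
      by blast
    with e have "emeasure ?D {h} = emeasure (play_measure \<sigma> \<tau>) {\<omega>. \<forall>t<n. \<omega> t = h ! t}"
      by (simp only:)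
    also have "\<dots> = ennreal (pmf (history_pmf \<sigma> \<tau> n) h)"
      using pmf_history[of \<sigma> \<tau> n "\<lambda>t. h ! t", unfolded h]
      by (simp add: emeasure_play_prefix prod_ennreal)
    finally show ?thesis by (simp only: emeasure_pmf_single)
  next
    case False
    then have "(\<lambda>\<omega>. past \<omega> n) -` {h} = {}" by auto
    moreover have "h \<notin> set_pmf (history_pmf \<sigma> \<tau> n)" using False length_history_pmf by blast
    ultimately show ?thesis using e by (simp add: emeasure_pmf_single set_pmf_eq)
  qed
qed (rule sets_distr[THEN trans] | simp only: sets_measure_pmf sets_count_space Pow_UNIV | rule countableI_type)+

lemma integral_past:
  fixes \<sigma> :: "('m::finite, 'n::finite) strategy1" and F :: "('m, 'n) history \<Rightarrow> real"
  shows "(LINT \<omega>|play_measure \<sigma> \<tau>. F (past \<omega> n)) = measure_pmf.expectation (history_pmf \<sigma> \<tau> n) F"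
  using integral_distr[OF measurable_past[of n \<sigma> \<tau>], of F] by (simp only: distr_past) simp

lemma integrable_past:
  fixes \<sigma> :: "('m::finite, 'n::finite) strategy1" and F :: "('m, 'n) history \<Rightarrow> real"
  shows "integrable (play_measure \<sigma> \<tau>) (\<lambda>\<omega>. F (past \<omega> n))"
proof -
  have "integrable (distr (play_measure \<sigma> \<tau>) (count_space UNIV) (\<lambda>\<omega>. past \<omega> n)) F"
    by (simp only: distr_past) (rule integrable_measure_pmf_finite[OF finite_set_history_pmf])
  then show ?thesis
    by (rule integrable_distr[OF measurable_past])
qed

lemma expectation_history_Suc:
  fixes \<sigma> :: "('m::finite, 'n::finite) strategy1" and F :: "('m, 'n) history \<Rightarrow> real"
  shows "measure_pmf.expectation (history_pmf \<sigma> \<tau> (Suc n)) F =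
    measure_pmf.expectation (history_pmf \<sigma> \<tau> n)
      (\<lambda>h. measure_pmf.expectation (pair_pmf (\<sigma> h) (\<tau> h)) (\<lambda>a. F (h @ [a])))"
proof -
  let ?A = "set_pmf (history_pmf \<sigma> \<tau> n)"
  have "measure_pmf.expectation (history_pmf \<sigma> \<tau> (Suc n)) F = (\<Sum>h\<in>?A. pmf (history_pmf \<sigma> \<tau> n) h *\<^sub>R
      measure_pmf.expectation (map_pmf (\<lambda>a. h @ [a]) (pair_pmf (\<sigma> h) (\<tau> h))) F)"
    unfolding history_pmf.simps
    by (rule pmf_expectation_bind[OF finite_set_history_pmf _ order_refl]) simp
  also have "\<dots> = measure_pmf.expectation (history_pmf \<sigma> \<tau> n)
      (\<lambda>h. measure_pmf.expectation (pair_pmf (\<sigma> h) (\<tau> h)) (\<lambda>a. F (h @ [a])))"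
    by (simp add: integral_measure_pmf[OF finite_set_history_pmf])
  finally show ?thesis .
qed

section \<open>A one-sided law of large numbers\<close>

text \<open>
  The sum is formed on finite histories rather than on plays, so that expectations can be taken
  under \<open>history_pmf\<close>; \<open>D\<close> maps the preceding history and the actions of a stage to its income.
\<close>

definition running_sum :: "('a list \<Rightarrow> 'a \<Rightarrow> real) \<Rightarrow> 'a list \<Rightarrow> real" where
  "running_sum D h = (\<Sum>t<length h. D (take t h) (h ! t))"

lemma running_sum_Nil [simp]: "running_sum D [] = 0"
  by (simp add: running_sum_def)

lemma running_sum_snoc [simp]: "running_sum D (h @ [a]) = running_sum D h + D h a"
  by (simp add: running_sum_def nth_append)

lemma running_sum_past: "running_sum D (past \<omega> n) = (\<Sum>t<n. D (past \<omega> t) (\<omega> t))"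
  by (induction n) simp_all

lemma running_sum_past_Suc:
  "running_sum D (past \<omega> (Suc n)) = running_sum D (past \<omega> n) + D (past \<omega> n) (\<omega> n)"
  by (simp only: running_sum_past sum.lessThan_Suc)

text \<open>
  This bound turns a nonpositive conditional mean into a bound on exponential moments: the linear
  term disappears and only a second-order term remains.
\<close>

lemma exp_le_quadratic:
  fixes x :: real
  assumes "\<bar>x\<bar> \<le> 1"
  shows "exp x \<le> 1 + x + x\<^sup>2"
proof (cases "0 \<le> x")
  case True
  then show ?thesis using assms exp_bound[of x] by simp
next
  case False
  have pos: "0 < 1 - x" using False by simp
  have "exp x \<le> 1 / (1 - x)"
    using exp_ge_add_one_self[of "- x"] pos
    by (simp add: exp_minus field_simps)
  also have "\<dots> \<le> 1 + x + x\<^sup>2"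
  proof -
    have "0 \<le> - (x ^ 3)" using False by (simp add: power3_eq_cube mult_nonneg_nonpos2 zero_le_mult_iff mult_le_0_iff)
    then have "1 \<le> (1 + x + x\<^sup>2) * (1 - x)" by (simp add: algebra_simps power2_eq_square power3_eq_cube)
    then show ?thesis using pos by (simp add: divide_le_eq)
  qed
  finally show ?thesis .
qed

text \<open>
  Given the history, the factor contributed by one more stage has mean at most
  \<open>1 + l E D + (l B)\<^sup>2 \<le> exp ((l B)\<^sup>2)\<close>, whatever the strategies do, so the factors can be peeled off
  one at a time although the stages are dependent.
\<close>

lemma expectation_exp_running_sum_le:
  fixes \<sigma> :: "('m::finite, 'n::finite) strategy1"
  assumes bound: "\<And>h a. \<bar>D h a\<bar> \<le> B"
    and drift: "\<And>h. measure_pmf.expectation (pair_pmf (\<sigma> h) (\<tau> h)) (D h) \<le> 0"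
    and l: "0 < l" "l * B \<le> 1"
  shows "measure_pmf.expectation (history_pmf \<sigma> \<tau> n) (\<lambda>h. exp (l * running_sum D h)) \<le> exp ((l * B)\<^sup>2) ^ n"
proof (induction n)
  case (Suc n)
  have int: "integrable (measure_pmf (history_pmf \<sigma> \<tau> m)) F" for F :: "_ \<Rightarrow> real" and m
    by (intro integrable_measure_pmf_finite finite_set_history_pmf)
  have int2: "integrable (measure_pmf (p :: ('m \<times> 'n) pmf)) F" for F :: "_ \<Rightarrow> real" and p
    by (intro integrable_measure_pmf_finite) simp
  have step: "measure_pmf.expectation (pair_pmf (\<sigma> h) (\<tau> h)) (\<lambda>a. exp (l * D h a)) \<le> exp ((l * B)\<^sup>2)" for h
  proof -
    let ?p = "pair_pmf (\<sigma> h) (\<tau> h)"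
    have b: "exp (l * D h a) \<le> 1 + l * D h a + (l * B)\<^sup>2" for a
    proof -
      have "\<bar>l * D h a\<bar> \<le> l * B" using bound[of h a] l by (simp add: abs_mult)
      then have "exp (l * D h a) \<le> 1 + l * D h a + (l * D h a)\<^sup>2" "(l * D h a)\<^sup>2 \<le> (l * B)\<^sup>2"
        using l(2) by (auto intro!: exp_le_quadratic simp: abs_le_square_iff[symmetric])
      then show ?thesis by linarith
    qed
    have "measure_pmf.expectation ?p (\<lambda>a. exp (l * D h a)) \<le> measure_pmf.expectation ?p (\<lambda>a. 1 + l * D h a + (l * B)\<^sup>2)"
      by (intro integral_mono int2 b)
    also have "\<dots> = 1 + l * measure_pmf.expectation ?p (D h) + (l * B)\<^sup>2"
      by (simp add: int2)
    also have "\<dots> \<le> 1 + (l * B)\<^sup>2"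
      using mult_nonneg_nonpos[OF less_imp_le[OF l(1)] drift[of h]] by linarith
    also have "\<dots> \<le> exp ((l * B)\<^sup>2)" by (rule exp_ge_add_one_self)
    finally show ?thesis .
  qed
  have "measure_pmf.expectation (history_pmf \<sigma> \<tau> (Suc n)) (\<lambda>h. exp (l * running_sum D h)) =
     measure_pmf.expectation (history_pmf \<sigma> \<tau> n)
       (\<lambda>h. exp (l * running_sum D h) * measure_pmf.expectation (pair_pmf (\<sigma> h) (\<tau> h)) (\<lambda>a. exp (l * D h a)))"
    by (simp add: expectation_history_Suc distrib_left exp_add del: history_pmf.simps)
  also have "\<dots> \<le> measure_pmf.expectation (history_pmf \<sigma> \<tau> n) (\<lambda>h. exp (l * running_sum D h) * exp ((l * B)\<^sup>2))"
    by (intro integral_mono int mult_left_mono step) simp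
  also have "\<dots> = measure_pmf.expectation (history_pmf \<sigma> \<tau> n) (\<lambda>h. exp (l * running_sum D h)) * exp ((l * B)\<^sup>2)"
    by simp
  also have "\<dots> \<le> exp ((l * B)\<^sup>2) ^ n * exp ((l * B)\<^sup>2)"
    by (intro mult_right_mono Suc) simp
  finally show ?case by (simp del: history_pmf.simps add: mult.commute)
qed simp

text \<open>
  Chernoff's argument. Discounting \<open>exp (l * running_sum D)\<close> by twice its exponential growth rate
  gives a sequence whose expectations are summable; hence almost surely the sequence itself is
  summable and tends to \<open>0\<close>. Its being below \<open>1\<close> says that the cumulative income is at most
  \<open>2 l B\<^sup>2 T\<close>, and \<open>l\<close> may be as small as desired.
\<close>

lemma AE_running_sum_le:
  fixes \<sigma> :: "('m::finite, 'n::finite) strategy1"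
  assumes bound: "\<And>h a. \<bar>D h a\<bar> \<le> B" and "0 < B"
    and drift: "\<And>h. measure_pmf.expectation (pair_pmf (\<sigma> h) (\<tau> h)) (D h) \<le> 0"
    and "0 < \<epsilon>"
  shows "AE \<omega> in play_measure \<sigma> \<tau>. \<forall>\<^sub>F T in sequentially. running_sum D (past \<omega> T) \<le> \<epsilon> * real T"
proof -
  \<comment> \<open>The first bound is what the quadratic estimate needs, the second one makes
    the final slope \<open>2 * l * B\<^sup>2\<close> at most \<open>\<epsilon>\<close>.\<close>
  define l where "l = min (1 / B) (\<epsilon> / (2 * B\<^sup>2))"
  have l: "0 < l" "l * B \<le> 1" "2 * l * B\<^sup>2 \<le> \<epsilon>"
  proof -
    show "0 < l" using \<open>0 < B\<close> \<open>0 < \<epsilon>\<close> by (simp add: l_def)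
    have "l \<le> 1 / B" "l \<le> \<epsilon> / (2 * B\<^sup>2)" by (simp_all add: l_def)
    with \<open>0 < B\<close> show "l * B \<le> 1" "2 * l * B\<^sup>2 \<le> \<epsilon>"
      by (simp_all add: pos_le_divide_eq mult_ac)
  qed
  define q where "q = exp ((l * B)\<^sup>2)"
  have q: "1 < q" using l \<open>0 < B\<close> by (simp add: q_def)
  define f where "f T \<omega> = exp (l * running_sum D (past \<omega> T)) / q ^ (2 * T)" for T and \<omega> :: "nat \<Rightarrow> 'm \<times> 'n"
  have f_pos: "0 < f T \<omega>" for T \<omega> using q by (simp add: f_def)
  have meas[measurable]: "f T \<in> borel_measurable (play_measure \<sigma> \<tau>)" for T
    unfolding f_def by (rule measurable_compose[OF measurable_past]) simp
  have E: "(\<integral>\<^sup>+\<omega>. ennreal (f T \<omega>) \<partial>play_measure \<sigma> \<tau>) \<le> ennreal ((1 / q) ^ T)" for T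
  proof -
    have "(\<integral>\<^sup>+\<omega>. ennreal (f T \<omega>) \<partial>play_measure \<sigma> \<tau>) = ennreal (LINT \<omega>|play_measure \<sigma> \<tau>. f T \<omega>)"
      using f_pos unfolding f_def
      by (intro nn_integral_eq_integral integrable_past) (auto intro: less_imp_le)
    also have "(LINT \<omega>|play_measure \<sigma> \<tau>. f T \<omega>) =
        measure_pmf.expectation (history_pmf \<sigma> \<tau> T) (\<lambda>h. exp (l * running_sum D h)) / q ^ (2 * T)"
      unfolding f_def by (subst integral_past) simp
    also have "\<dots> \<le> q ^ T / q ^ (2 * T)"
      using q expectation_exp_running_sum_le[OF bound drift l(1,2), where n = T] by (intro divide_right_mono) (auto simp: q_def)
    also have "\<dots> = (1 / q) ^ T" using q by (simp add: power_add mult_2 power_divide)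
    finally show ?thesis by (simp add: ennreal_leI)
  qed
  have "(\<integral>\<^sup>+\<omega>. (\<Sum>T. ennreal (f T \<omega>)) \<partial>play_measure \<sigma> \<tau>) = (\<Sum>T. \<integral>\<^sup>+\<omega>. ennreal (f T \<omega>) \<partial>play_measure \<sigma> \<tau>)"
    by (rule nn_integral_suminf) simp
  also have "\<dots> \<le> (\<Sum>T. ennreal ((1 / q) ^ T))"
    by (intro suminf_le E) auto
  also have "\<dots> < \<infinity>"
    using q by (subst suminf_ennreal2) (auto intro: summable_geometric)
  finally have "AE \<omega> in play_measure \<sigma> \<tau>. (\<Sum>T. ennreal (f T \<omega>)) \<noteq> \<infinity>"
    by (intro nn_integral_PInf_AE) auto
  then show ?thesis
  proof eventually_elim
    case (elim \<omega>)
    then have "summable (\<lambda>T. f T \<omega>)"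
      using f_pos by (intro summable_suminf_not_top) (auto intro: less_imp_le)
    then have "(\<lambda>T. f T \<omega>) \<longlonglongrightarrow> 0" by (rule summable_LIMSEQ_zero)
    then have "\<forall>\<^sub>F T in sequentially. f T \<omega> < 1" by (rule order_tendstoD) simp
    then show ?case
    proof eventually_elim
      case (elim T)
      have "exp (l * running_sum D (past \<omega> T)) < q ^ (2 * T)" using elim q by (simp add: f_def)
      also have "\<dots> = exp (real (2 * T) * (l * B)\<^sup>2)" unfolding q_def by (rule exp_of_nat_mult[symmetric])
      finally have "l * running_sum D (past \<omega> T) < l * (2 * l * B\<^sup>2 * real T)"
        by (simp add: power2_eq_square algebra_simps)
      then have "running_sum D (past \<omega> T) < 2 * l * B\<^sup>2 * real T" using l(1) by simp
      also have "\<dots> \<le> \<epsilon> * real T" using l(3) by (intro mult_right_mono) auto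
      finally show ?case by simp
    qed
  qed
qed

section \<open>Long-run payoffs\<close>

lemma expectation_finite:
  fixes p :: "'a::finite pmf" and f :: "'a \<Rightarrow> real"
  shows "measure_pmf.expectation p f = (\<Sum>i\<in>UNIV. pmf p i * f i)"
  by (subst integral_measure_pmf_real[of UNIV]) (simp_all add: mult.commute)

lemma expectation_pair_finite:
  fixes p :: "'a::finite pmf" and q :: "'b::finite pmf" and f :: "'a \<times> 'b \<Rightarrow> real"
  shows "measure_pmf.expectation (pair_pmf p q) f =
    measure_pmf.expectation p (\<lambda>i. measure_pmf.expectation q (\<lambda>j. f (i, j)))"
proof -
  have "measure_pmf.expectation (pair_pmf p q) f = (\<Sum>(i, j)\<in>UNIV \<times> UNIV. pmf p i * pmf q j * f (i, j))"
    unfolding expectation_finite by (rule sum.cong) (auto simp: pmf_pair)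
  also have "\<dots> = (\<Sum>i\<in>UNIV. \<Sum>j\<in>UNIV. pmf p i * pmf q j * f (i, j))"
    by (rule sum.cartesian_product[symmetric])
  finally show ?thesis by (simp add: expectation_finite sum_distrib_left mult.assoc)
qed

lemma integrable_finite_pmf [simp]:
  fixes p :: "'a::finite pmf" and f :: "'a \<Rightarrow> real"
  shows "integrable (measure_pmf p) f"
  by (rule integrable_measure_pmf_finite) simp

definition round_payoff ::
  "real^'n^'m \<Rightarrow> real^'n^'n \<Rightarrow> real \<Rightarrow> ('m, 'n) history \<Rightarrow> 'm \<times> 'n \<Rightarrow> real" where
  "round_payoff A S c h a =
     A $ fst a $ snd a + (if h = [] then 0 else c * S $ snd (last h) $ snd a)"

lemma stage_payoff_eq: "stage_payoff A S c \<omega> t = round_payoff A S c (past \<omega> t) (\<omega> t)"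
  by (cases t) (simp_all add: stage_payoff_def round_payoff_def)

lemma sum_stage_payoff:
  "(\<Sum>t<T. stage_payoff A S c \<omega> t) = running_sum (round_payoff A S c) (past \<omega> T)"
  by (simp add: running_sum_past stage_payoff_eq)

definition long_run_payoff :: "real^'n^'m \<Rightarrow> real^'n^'n \<Rightarrow> real \<Rightarrow> (nat \<Rightarrow> 'm \<times> 'n) \<Rightarrow> real" where
  "long_run_payoff A S c \<omega> =
     real_of_ereal (liminf (\<lambda>T. ereal (running_sum (round_payoff A S c) (past \<omega> T) / real T)))"

lemma payoff_eq: "payoff A S c \<sigma> \<tau> = (LINT \<omega>|play_measure \<sigma> \<tau>. long_run_payoff A S c \<omega>)"
  by (simp add: payoff_def long_run_payoff_def sum_stage_payoff)

lemma ereal_liminf_bounded: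
  fixes X :: "nat \<Rightarrow> real"
  assumes "\<And>n. 0 \<le> X n" "\<And>n. X n \<le> K"
  obtains r where "liminf (\<lambda>n. ereal (X n)) = ereal r" "0 \<le> r" "r \<le> K"
proof -
  have "ereal 0 \<le> liminf (\<lambda>n. ereal (X n))"
    using assms by (intro Liminf_bounded) auto
  moreover have "liminf (\<lambda>n. ereal (X n)) \<le> ereal K"
  proof -
    have "liminf (\<lambda>n. ereal (X n)) \<le> limsup (\<lambda>n. ereal (X n))" by (rule Liminf_le_Limsup) simp
    also have "\<dots> \<le> ereal K" using assms by (intro Limsup_bounded) auto
    finally show ?thesis .
  qed
  ultimately show thesis using that
    by (cases "liminf (\<lambda>n. ereal (X n))") auto
qed

lemma average_bounds:
  assumes "\<And>h a. 0 \<le> D h a" "\<And>h a. D h a \<le> K"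
  shows "0 \<le> running_sum D h / real (length h)" "0 < K \<Longrightarrow> running_sum D h / real (length h) \<le> K"
proof -
  show "0 \<le> running_sum D h / real (length h)" using assms(1) by (simp add: running_sum_def sum_nonneg)
  assume "0 < K"
  have "running_sum D h \<le> real (length h) * K" unfolding running_sum_def
    using sum_bounded_above[of "{..<length h}" "\<lambda>t. D (take t h) (h ! t)" K] assms(2) by simp
  with \<open>0 < K\<close> show "running_sum D h / real (length h) \<le> K"
    by (cases "h = []") (simp_all add: divide_le_eq mult.commute)
qed

text \<open>
  The cost parameter stays outside the locale because the value is studied as a function of it.
\<close>

locale nonneg_game =
  fixes A :: "real^'n::finite^'m::finite" and S :: "real^'n^'n"
  assumes A_nonneg: "0 \<le> A $ i $ j" and S_nonneg: "0 \<le> S $ k $ j"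
begin

lemma round_payoff_bounds:
  assumes "0 \<le> c"
  obtains K where "0 < K" "\<And>h a. 0 \<le> round_payoff A S c h a" "\<And>h a. round_payoff A S c h a \<le> K"
proof
  define K where "K = (\<Sum>i\<in>UNIV. \<Sum>j\<in>UNIV. A $ i $ j) + c * (\<Sum>k\<in>UNIV. \<Sum>j\<in>UNIV. S $ k $ j) + 1"
  have A_le: "A $ i $ j \<le> (\<Sum>i\<in>UNIV. \<Sum>j\<in>UNIV. A $ i $ j)" for i j
  proof -
    have "A $ i $ j \<le> (\<Sum>j\<in>UNIV. A $ i $ j)" by (rule member_le_sum) (auto simp: A_nonneg)
    also have "\<dots> \<le> (\<Sum>i\<in>UNIV. \<Sum>j\<in>UNIV. A $ i $ j)"
      by (rule member_le_sum) (auto simp: A_nonneg sum_nonneg)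
    finally show ?thesis .
  qed
  have S_le: "S $ i $ j \<le> (\<Sum>i\<in>UNIV. \<Sum>j\<in>UNIV. S $ i $ j)" for i j
  proof -
    have "S $ i $ j \<le> (\<Sum>j\<in>UNIV. S $ i $ j)" by (rule member_le_sum) (auto simp: S_nonneg)
    also have "\<dots> \<le> (\<Sum>i\<in>UNIV. \<Sum>j\<in>UNIV. S $ i $ j)"
      by (rule member_le_sum) (auto simp: S_nonneg sum_nonneg)
    finally show ?thesis .
  qed
  show "0 < K" using assms unfolding K_def
    by (intro add_nonneg_pos add_nonneg_nonneg mult_nonneg_nonneg sum_nonneg) (auto simp: A_nonneg S_nonneg)
  fix h :: "('m \<times> 'n) list" and a
  show "0 \<le> round_payoff A S c h a"
    using assms by (auto simp: round_payoff_def A_nonneg S_nonneg)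
  show "round_payoff A S c h a \<le> K"
  proof -
    have 1: "0 \<le> (\<Sum>k\<in>UNIV. \<Sum>j\<in>UNIV. S $ k $ j)" by (intro sum_nonneg) (auto simp: S_nonneg)
    have "c * S $ snd (last h) $ snd a \<le> c * (\<Sum>k\<in>UNIV. \<Sum>j\<in>UNIV. S $ k $ j)"
      using assms by (intro mult_left_mono S_le) auto
    then show ?thesis using A_le[of "fst a" "snd a"] mult_nonneg_nonneg[OF assms 1]
      by (simp add: round_payoff_def K_def)
  qed
qed

lemma long_run_payoff_bounds:
  assumes "0 \<le> c"
  obtains K where "0 < K"
    "\<And>\<omega>. liminf (\<lambda>T. ereal (running_sum (round_payoff A S c) (past \<omega> T) / real T)) = ereal (long_run_payoff A S c \<omega>)"
    "\<And>\<omega>. 0 \<le> long_run_payoff A S c \<omega>" "\<And>\<omega>. long_run_payoff A S c \<omega> \<le> K"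
proof -
  obtain K where K: "0 < K" "\<And>h a. 0 \<le> round_payoff A S c h a" "\<And>h a. round_payoff A S c h a \<le> K"
    using round_payoff_bounds[OF assms] by blast
  have "liminf (\<lambda>T. ereal (running_sum (round_payoff A S c) (past \<omega> T) / real T)) = ereal (long_run_payoff A S c \<omega>) \<and>
     0 \<le> long_run_payoff A S c \<omega> \<and> long_run_payoff A S c \<omega> \<le> K" for \<omega>
  proof -
    obtain r where "liminf (\<lambda>T. ereal (running_sum (round_payoff A S c) (past \<omega> T) / real T)) = ereal r" "0 \<le> r" "r \<le> K"
    proof (rule ereal_liminf_bounded)
      fix T
      show "0 \<le> running_sum (round_payoff A S c) (past \<omega> T) / real T"
        "running_sum (round_payoff A S c) (past \<omega> T) / real T \<le> K"
        using average_bounds[OF K(2,3), where h = "past \<omega> T"] K(1) by simp_all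
    qed
    then show ?thesis by (simp add: long_run_payoff_def)
  qed
  then show thesis using that K(1) by blast
qed

lemma integrable_long_run_payoff:
  fixes \<sigma> :: "('m, 'n) strategy1"
  assumes "0 \<le> c"
  shows "integrable (play_measure \<sigma> \<tau>) (long_run_payoff A S c)"
proof -
  interpret prob_space "play_measure \<sigma> \<tau>" by (rule prob_space_play_measure)
  obtain K where K: "0 < K" "\<And>\<omega>. 0 \<le> long_run_payoff A S c \<omega>" "\<And>\<omega>. long_run_payoff A S c \<omega> \<le> K"
    using long_run_payoff_bounds[OF assms] by metis
  have "(\<lambda>\<omega>. ereal (running_sum (round_payoff A S c) (past \<omega> T) / real T)) \<in> borel_measurable (play_measure \<sigma> \<tau>)" for T
    by (rule measurable_compose[OF measurable_past]) simp
  then have "long_run_payoff A S c \<in> borel_measurable (play_measure \<sigma> \<tau>)"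
    unfolding long_run_payoff_def[abs_def]
    by (intro borel_measurable_real_of_ereal borel_measurable_liminf)
  then show ?thesis
    using K by (intro integrable_const_bound[of _ K]) (auto simp: abs_le_iff intro!: AE_I2)
qed

lemma payoff_bounds:
  assumes "0 \<le> c"
  obtains K where "\<And>\<sigma> \<tau>. 0 \<le> payoff A S c \<sigma> \<tau>" "\<And>\<sigma> \<tau>. payoff A S c \<sigma> \<tau> \<le> K"
proof -
  obtain K where K: "0 < K" "\<And>\<omega>. 0 \<le> long_run_payoff A S c \<omega>" "\<And>\<omega>. long_run_payoff A S c \<omega> \<le> K"
    using long_run_payoff_bounds[OF assms] by metis
  have "0 \<le> payoff A S c \<sigma> \<tau>" "payoff A S c \<sigma> \<tau> \<le> K" for \<sigma> \<tau>
  proof -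
    interpret prob_space "play_measure \<sigma> \<tau>" by (rule prob_space_play_measure)
    show "0 \<le> payoff A S c \<sigma> \<tau>" unfolding payoff_eq using K by (simp add: integral_nonneg_AE)
    show "payoff A S c \<sigma> \<tau> \<le> K" unfolding payoff_eq
      using K by (intro integral_le_const integrable_long_run_payoff assms) simp
  qed
  then show thesis using that by blast
qed

text \<open>
  A potential \<open>\<phi>\<close> on Player 2's actions lets the expected payoff of a stage be small as long as the
  potential rises accordingly. Summed over time the potential telescopes and stays bounded, so the
  average payoff is asymptotically at least \<open>W\<close>. Since the payoff is the mean of a limit inferior,
  bounds on the mean averages do not suffice here; the law of large numbers is applied to the
  stagewise shortfall \<open>D\<close>.
\<close>

lemma payoff_ge_potential:
  fixes \<phi> :: "'n \<Rightarrow> real"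
  assumes "0 \<le> c"
    and drift: "\<And>h. h \<noteq> [] \<Longrightarrow> W + \<phi> (snd (last h)) \<le>
      measure_pmf.expectation (pair_pmf (\<sigma> h) (\<tau> h)) (\<lambda>a. round_payoff A S c h a + \<phi> (snd a))"
  shows "W \<le> payoff A S c \<sigma> \<tau>"
proof (rule field_le_epsilon)
  fix e :: real assume "0 < e"
  define \<epsilon> where "\<epsilon> = e / 2"
  have \<epsilon>: "0 < \<epsilon>" using \<open>0 < e\<close> by (simp_all add: \<epsilon>_def)
  interpret prob_space "play_measure \<sigma> \<tau>" by (rule prob_space_play_measure)
  obtain K where K: "0 < K" "\<And>h a. 0 \<le> round_payoff A S c h a" "\<And>h a. round_payoff A S c h a \<le> K"
    using round_payoff_bounds[OF assms(1)] by blast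
  define \<Phi> where "\<Phi> = (\<Sum>j\<in>UNIV. \<bar>\<phi> j\<bar>)"
  have \<Phi>: "\<bar>\<phi> j\<bar> \<le> \<Phi>" for j unfolding \<Phi>_def by (rule member_le_sum) auto
  have \<Phi>_nonneg: "0 \<le> \<Phi>" using \<Phi>[of undefined] by linarith
  \<comment> \<open>At the first stage there is no previous action and hence no potential to
    compare with; this single stage does not influence the average.\<close>
  define D where "D h a = (if h = [] then 0
     else W + \<phi> (snd (last h)) - (round_payoff A S c h a + \<phi> (snd a)))" for h and a :: "'m \<times> 'n"
  have "\<bar>D h a\<bar> \<le> \<bar>W\<bar> + 2 * \<Phi> + K" for h a
    using K(2,3)[of h a] K(1) \<Phi>[of "snd (last h)"] \<Phi>[of "snd a"] by (auto simp: D_def)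
  moreover have "0 < \<bar>W\<bar> + 2 * \<Phi> + K" using K(1) \<Phi>_nonneg by linarith
  moreover have "measure_pmf.expectation (pair_pmf (\<sigma> h) (\<tau> h)) (D h) \<le> 0" for h
  proof (cases "h = []")
    case False
    then have "D h = (\<lambda>a. W + \<phi> (snd (last h)) - (round_payoff A S c h a + \<phi> (snd a)))"
      by (simp add: D_def fun_eq_iff)
    then show ?thesis using drift[OF False] by simp
  qed (simp add: D_def[abs_def])
  ultimately have "AE \<omega> in play_measure \<sigma> \<tau>. \<forall>\<^sub>F T in sequentially. running_sum D (past \<omega> T) \<le> \<epsilon> * real T"
    by (rule AE_running_sum_le[OF _ _ _ \<epsilon>])
  then have "AE \<omega> in play_measure \<sigma> \<tau>. W - e \<le> long_run_payoff A S c \<omega>"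
  proof eventually_elim
    case (elim \<omega>)
    have telescope: "running_sum D (past \<omega> (Suc T)) = real T * W + \<phi> (snd (\<omega> 0)) - \<phi> (snd (\<omega> T))
        + round_payoff A S c [] (\<omega> 0) - running_sum (round_payoff A S c) (past \<omega> (Suc T))" for T
    proof (induction T)
      case (Suc T)
      have "D (past \<omega> (Suc T)) (\<omega> (Suc T)) = W + \<phi> (snd (\<omega> T))
          - (round_payoff A S c (past \<omega> (Suc T)) (\<omega> (Suc T)) + \<phi> (snd (\<omega> (Suc T))))"
        by (simp add: D_def)
      then show ?case
        using Suc unfolding running_sum_past_Suc[of _ _ "Suc T"]
        by (simp add: algebra_simps del: upt_Suc)
    qed (simp add: running_sum_def D_def)
    have "(\<lambda>T. (\<bar>W\<bar> + 2 * \<Phi>) / real T) \<longlonglongrightarrow> 0" by (rule lim_const_over_n)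
    then have "\<forall>\<^sub>F T in sequentially. (\<bar>W\<bar> + 2 * \<Phi>) / real T < \<epsilon>"
      using \<epsilon> by (rule order_tendstoD)
    then have "\<forall>\<^sub>F T in sequentially. W - e \<le> running_sum (round_payoff A S c) (past \<omega> T) / real T"
      using elim eventually_gt_at_top[of 0]
    proof eventually_elim
      case (elim T)
      obtain T' where T': "T = Suc T'" using elim(3) by (cases T) auto
      have "running_sum (round_payoff A S c) (past \<omega> T) \<ge> real T * W - W - 2 * \<Phi> - \<epsilon> * real T"
        using telescope[of T'] elim(2) K(2)[of "[]" "\<omega> 0"] \<Phi>[of "snd (\<omega> 0)"] \<Phi>[of "snd (\<omega> T')"]
        unfolding T' by (simp add: algebra_simps)
      moreover have "\<bar>W\<bar> + 2 * \<Phi> \<le> \<epsilon> * real T" using elim(1,3) by (simp add: divide_less_eq)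
      moreover have "(W - e) * real T = real T * W - \<epsilon> * real T - \<epsilon> * real T"
        by (simp add: \<epsilon>_def algebra_simps)
      ultimately have "running_sum (round_payoff A S c) (past \<omega> T) \<ge> (W - e) * real T"
        by linarith
      then show ?case using elim(3) by (simp add: le_divide_eq)
    qed
    then have "ereal (W - e) \<le> liminf (\<lambda>T. ereal (running_sum (round_payoff A S c) (past \<omega> T) / real T))"
      by (intro Liminf_bounded) (auto elim: eventually_mono)
    also have "\<dots> = ereal (long_run_payoff A S c \<omega>)"
      using long_run_payoff_bounds[OF assms(1)] by metis
    finally show ?case by simp
  qed
  then have "W - e \<le> payoff A S c \<sigma> \<tau>" unfolding payoff_eq
    by (intro integral_ge_const integrable_long_run_payoff assms)
  then show "W \<le> payoff A S c \<sigma> \<tau> + e" by simp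
qed

text \<open>
  In the other direction the limit inferior helps: by Fatou's lemma its mean is at most the limit
  inferior of the mean averages.
\<close>

lemma payoff_le_mean:
  assumes "0 \<le> c"
    and mean: "\<And>n. measure_pmf.expectation (history_pmf \<sigma> \<tau> n) (running_sum (round_payoff A S c)) \<le> real n * W + C"
  shows "payoff A S c \<sigma> \<tau> \<le> W"
proof -
  interpret prob_space "play_measure \<sigma> \<tau>" by (rule prob_space_play_measure)
  obtain K where K: "0 < K" "\<And>h a. 0 \<le> round_payoff A S c h a" "\<And>h a. round_payoff A S c h a \<le> K"
    using round_payoff_bounds[OF assms(1)] by blast
  define X where "X T \<omega> = running_sum (round_payoff A S c) (past \<omega> T) / real T" for T \<omega>
  have X_nonneg: "0 \<le> X T \<omega>" for T \<omega>
    using average_bounds(1)[OF K(2,3), where h = "past \<omega> T"] by (simp add: X_def)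
  have X_meas: "(\<lambda>\<omega>. ennreal (X T \<omega>)) \<in> borel_measurable (play_measure \<sigma> \<tau>)" for T
    unfolding X_def by (rule measurable_compose[OF measurable_past]) simp
  have L: "liminf (\<lambda>T. ereal (X T \<omega>)) = ereal (long_run_payoff A S c \<omega>)" "0 \<le> long_run_payoff A S c \<omega>" for \<omega>
    using long_run_payoff_bounds[OF assms(1)] unfolding X_def by metis+
  have pw: "ennreal (long_run_payoff A S c \<omega>) \<le> liminf (\<lambda>T. ennreal (X T \<omega>))" for \<omega>
  proof -
    have "ennreal (long_run_payoff A S c \<omega>) = e2ennreal (liminf (\<lambda>T. ereal (X T \<omega>)))"
      by (simp add: L)
    also have "\<dots> \<le> liminf (\<lambda>T. e2ennreal (ereal (X T \<omega>)))"
      by (subst Liminf_compose_continuous_mono[symmetric])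
        (auto intro!: continuous_on_e2ennreal monoI e2ennreal_mono)
    finally show ?thesis by simp
  qed
  have "ennreal (payoff A S c \<sigma> \<tau>) = (\<integral>\<^sup>+\<omega>. ennreal (long_run_payoff A S c \<omega>) \<partial>play_measure \<sigma> \<tau>)"
    unfolding payoff_eq using L(2)
    by (intro nn_integral_eq_integral[symmetric] integrable_long_run_payoff assms) auto
  also have "\<dots> \<le> (\<integral>\<^sup>+\<omega>. liminf (\<lambda>T. ennreal (X T \<omega>)) \<partial>play_measure \<sigma> \<tau>)"
    by (intro nn_integral_mono pw)
  also have "\<dots> \<le> liminf (\<lambda>T. \<integral>\<^sup>+\<omega>. ennreal (X T \<omega>) \<partial>play_measure \<sigma> \<tau>)"
    by (intro nn_integral_liminf X_meas)
  also have "\<dots> \<le> liminf (\<lambda>T. ennreal (W + C / real T))"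
  proof (rule Liminf_mono, rule eventually_mono[OF eventually_gt_at_top[of 0]])
    fix T :: nat assume "0 < T"
    have "(\<integral>\<^sup>+\<omega>. ennreal (X T \<omega>) \<partial>play_measure \<sigma> \<tau>) = ennreal (LINT \<omega>|play_measure \<sigma> \<tau>. X T \<omega>)"
      using X_nonneg unfolding X_def by (intro nn_integral_eq_integral integrable_past) auto
    also have "(LINT \<omega>|play_measure \<sigma> \<tau>. X T \<omega>) =
        measure_pmf.expectation (history_pmf \<sigma> \<tau> T) (running_sum (round_payoff A S c)) / real T"
      unfolding X_def by (subst integral_past) simp
    also have "\<dots> \<le> W + C / real T"
      using mean[of T] \<open>0 < T\<close> by (simp add: field_simps)
    finally show "(\<integral>\<^sup>+\<omega>. ennreal (X T \<omega>) \<partial>play_measure \<sigma> \<tau>) \<le> ennreal (W + C / real T)"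
      by (simp add: ennreal_leI)
  qed
  also have "\<dots> = ennreal W"
  proof -
    have "(\<lambda>T. W + C / real T) \<longlonglongrightarrow> W + 0" by (intro tendsto_add tendsto_const lim_const_over_n)
    then have "(\<lambda>T. ennreal (W + C / real T)) \<longlonglongrightarrow> ennreal W" by (intro tendsto_ennrealI) simp
    then show ?thesis by (intro lim_imp_Liminf) simp_all
  qed
  finally have le: "ennreal (payoff A S c \<sigma> \<tau>) \<le> ennreal W" .
  \<comment> \<open>Excludes the case that \<open>ennreal\<close> truncates a negative \<open>W\<close> to \<open>0\<close>.\<close>
  have "0 \<le> W"
  proof (rule field_le_epsilon)
    fix e :: real assume "0 < e"
    have "(\<lambda>T. C / real T) \<longlonglongrightarrow> 0" by (rule lim_const_over_n)
    then have "\<forall>\<^sub>F T in sequentially. C / real T < e" using \<open>0 < e\<close> by (rule order_tendstoD)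
    then obtain T where T: "C / real T < e" "0 < T"
      using eventually_happens'[OF _ eventually_conj[OF _ eventually_gt_at_top[of 0]]] by (metis sequentially_bot)
    have "0 \<le> measure_pmf.expectation (history_pmf \<sigma> \<tau> T) (running_sum (round_payoff A S c))"
      using K(2) by (intro integral_nonneg_AE AE_I2) (simp add: running_sum_def sum_nonneg)
    also have "\<dots> \<le> real T * W + C" by (rule mean)
    finally have "0 \<le> W + C / real T" using T(2) by (simp add: field_simps)
    then show "0 \<le> W + e" using T(1) by simp
  qed
  with le show ?thesis by (simp add: ennreal_le_iff)
qed

end

section \<open>Stationary strategies of Player 2\<close>

definition stationary_strategy :: "'n pmf \<Rightarrow> ('n \<Rightarrow> 'n pmf) \<Rightarrow> ('m, 'n) strategy2" where
  "stationary_strategy \<pi> p h = (if h = [] then \<pi> else p (snd (last h)))"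

lemma static_eq_stationary: "static_strategy y = stationary_strategy y (\<lambda>_. y)"
  by (simp add: static_strategy_def stationary_strategy_def fun_eq_iff)

text \<open>
  Player 2's action process does not react to Player 1: started in an invariant distribution, it
  keeps this marginal law whatever Player 1 does.
\<close>

lemma last_column_stationary:
  assumes "bind_pmf \<pi> p = \<pi>"
  shows "map_pmf (\<lambda>h. snd (last h)) (history_pmf \<sigma> (stationary_strategy \<pi> p) (Suc n)) = \<pi>"
proof (induction n)
  case 0
  show ?case
    by (simp add: stationary_strategy_def bind_return_pmf pmf.map_comp comp_def map_snd_pair_pmf)
next
  case (Suc n)
  let ?H = "history_pmf \<sigma> (stationary_strategy \<pi> p) (Suc n)"
  have "map_pmf (\<lambda>h. snd (last h)) (history_pmf \<sigma> (stationary_strategy \<pi> p) (Suc (Suc n))) =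
     bind_pmf ?H (\<lambda>h. stationary_strategy \<pi> p h)"
    unfolding history_pmf.simps(2)[of _ _ "Suc n"]
    by (simp add: map_bind_pmf pmf.map_comp comp_def map_snd_pair_pmf del: history_pmf.simps)
  also have "\<dots> = bind_pmf ?H (\<lambda>h. p (snd (last h)))"
    by (rule bind_pmf_cong[OF refl]) (auto simp: stationary_strategy_def dest!: length_history_pmf simp del: history_pmf.simps)
  also have "\<dots> = bind_pmf (map_pmf (\<lambda>h. snd (last h)) ?H) p"
    by (simp add: bind_map_pmf del: history_pmf.simps)
  also have "\<dots> = \<pi>" unfolding Suc by (rule assms)
  finally show ?case .
qed

context nonneg_game
begin

text \<open>
  Against a stationary strategy Player 1 can do no better than to reply to the previous action \<open>k\<close>,
  which earns at most \<open>g k\<close>, and \<open>k\<close> has law \<open>\<pi>\<close> at every stage after the first.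
\<close>

lemma payoff_stationary_le:
  assumes "0 \<le> c" and inv: "bind_pmf \<pi> p = \<pi>"
    and g: "\<And>k i. measure_pmf.expectation (p k) (\<lambda>j. A $ i $ j + c * S $ k $ j) \<le> g k"
    and W: "measure_pmf.expectation \<pi> g \<le> W"
  shows "payoff A S c \<sigma> (stationary_strategy \<pi> p) \<le> W"
proof -
  let ?\<tau> = "stationary_strategy \<pi> p :: ('m, 'n) strategy2"
  let ?E = "\<lambda>n. measure_pmf.expectation (history_pmf \<sigma> ?\<tau> n)"
  obtain K where K: "0 < K" "\<And>h a. 0 \<le> round_payoff A S c h a" "\<And>h a. round_payoff A S c h a \<le> K"
    using round_payoff_bounds[OF assms(1)] by blast
  have int: "integrable (measure_pmf (history_pmf \<sigma> ?\<tau> n)) F" for F :: "_ \<Rightarrow> real" and n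
    by (intro integrable_measure_pmf_finite finite_set_history_pmf)
  have step: "?E (Suc n) (running_sum (round_payoff A S c)) = ?E n (running_sum (round_payoff A S c)) +
      ?E n (\<lambda>h. measure_pmf.expectation (pair_pmf (\<sigma> h) (?\<tau> h)) (round_payoff A S c h))" for n
    unfolding expectation_history_Suc by (simp add: int)
  have later: "?E (Suc n) (\<lambda>h. measure_pmf.expectation (pair_pmf (\<sigma> h) (?\<tau> h)) (round_payoff A S c h)) \<le> W" for n
  proof -
    have "?E (Suc n) (\<lambda>h. measure_pmf.expectation (pair_pmf (\<sigma> h) (?\<tau> h)) (round_payoff A S c h)) \<le>
        ?E (Suc n) (\<lambda>h. g (snd (last h)))"
    proof (intro integral_mono_AE int, unfold AE_measure_pmf_iff, intro ballI)
      fix h assume "h \<in> set_pmf (history_pmf \<sigma> ?\<tau> (Suc n))"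
      then have h: "h \<noteq> []" using length_history_pmf by fastforce
      let ?k = "snd (last h)"
      have "measure_pmf.expectation (pair_pmf (\<sigma> h) (?\<tau> h)) (round_payoff A S c h) =
          measure_pmf.expectation (\<sigma> h) (\<lambda>i. measure_pmf.expectation (p ?k) (\<lambda>j. A $ i $ j + c * S $ ?k $ j))"
        using h by (simp add: expectation_pair_finite round_payoff_def stationary_strategy_def)
      also have "\<dots> \<le> measure_pmf.expectation (\<sigma> h) (\<lambda>i. g ?k)"
        by (intro integral_mono g integrable_finite_pmf)
      finally show "measure_pmf.expectation (pair_pmf (\<sigma> h) (?\<tau> h)) (round_payoff A S c h) \<le> g ?k" by simp
    qed
    also have "\<dots> = measure_pmf.expectation (map_pmf (\<lambda>h. snd (last h)) (history_pmf \<sigma> ?\<tau> (Suc n))) g"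
      by (simp only: integral_map_pmf)
    also have "\<dots> \<le> W" unfolding last_column_stationary[OF inv] by (rule W)
    finally show ?thesis .
  qed
  have first: "?E 0 (\<lambda>h. measure_pmf.expectation (pair_pmf (\<sigma> h) (?\<tau> h)) (round_payoff A S c h)) \<le> K"
  proof -
    have "measure_pmf.expectation (pair_pmf (\<sigma> []) (?\<tau> [])) (round_payoff A S c []) \<le>
        measure_pmf.expectation (pair_pmf (\<sigma> []) (?\<tau> [])) (\<lambda>_. K)"
      by (intro integral_mono K integrable_finite_pmf)
    then show ?thesis by simp
  qed
  have bound: "?E (Suc n) (running_sum (round_payoff A S c)) \<le> real n * W + K" for n
  proof (induction n)
    case 0
    then show ?case using first unfolding step by simp
  next
    case (Suc n)
    then show ?case unfolding step[of "Suc n"] using later[of n] by (simp add: algebra_simps)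
  qed
  have "?E n (running_sum (round_payoff A S c)) \<le> real n * W + (K + \<bar>W\<bar>)" for n
  proof (cases n)
    case (Suc m)
    show ?thesis using bound[of m] unfolding Suc by (simp add: algebra_simps del: history_pmf.simps)
  qed (use K(1) in simp)
  then show ?thesis by (rule payoff_le_mean[OF assms(1)])
qed

end

section \<open>Certificates and the linear programming alternative\<close>

lemma ex_pmf_finite:
  fixes f :: "'a::finite \<Rightarrow> real"
  assumes "\<And>i. 0 \<le> f i" "(\<Sum>i\<in>UNIV. f i) = 1"
  obtains p where "\<And>i. pmf p i = f i"
proof
  have "(\<integral>\<^sup>+i. ennreal (f i) \<partial>count_space UNIV) = ennreal (\<Sum>i\<in>UNIV. f i)"
    using assms(1) by (simp add: nn_integral_count_space_finite sum_ennreal)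
  then show "pmf (embed_pmf f) i = f i" for i
    using assms by (intro pmf_embed_pmf) simp_all
qed

text \<open>
  A certificate that Player 1 guarantees \<open>W\<close>: a reply \<open>x k\<close> to each previous action \<open>k\<close> of Player 2
  and a potential \<open>\<phi>\<close> which together satisfy the condition of \<open>payoff_ge_potential\<close> against every
  current action \<open>j\<close>. These are the feasible points of the dual of the linear program that
  minimizes the average payoff over circulations \<open>\<pi> k * p k j\<close>. Replies are real vectors instead of
  distributions because convex combinations of them are taken. The constraints are jointly affine
  in \<open>(c, W, x, \<phi>)\<close>, which is what makes the value concave in \<open>c\<close>.
\<close>

definition certified :: "real^'n^'m \<Rightarrow> real^'n^'n \<Rightarrow> real \<Rightarrow> real \<Rightarrow> bool" where
  "certified A S c W \<longleftrightarrow> (\<exists>(x :: 'n \<Rightarrow> 'm \<Rightarrow> real) \<phi> :: 'n \<Rightarrow> real.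
     (\<forall>k i. 0 \<le> x k i) \<and> (\<forall>k. (\<Sum>i\<in>UNIV. x k i) = 1) \<and>
     (\<forall>k j. W + \<phi> k \<le> (\<Sum>i\<in>UNIV. x k i * A $ i $ j) + c * S $ k $ j + \<phi> j))"

lemma certifiedI:
  fixes A :: "real^'n::finite^'m::finite" and x :: "'n \<Rightarrow> 'm \<Rightarrow> real"
  assumes "\<And>k i. 0 \<le> x k i" "\<And>k. (\<Sum>i\<in>UNIV. x k i) = 1"
    "\<And>k j. W + \<phi> k \<le> (\<Sum>i\<in>UNIV. x k i * A $ i $ j) + c * S $ k $ j + \<phi> j"
  shows "certified A S c W"
  unfolding certified_def using assms by blast

lemma certifiedE:
  fixes A :: "real^'n::finite^'m::finite"
  assumes "certified A S c W"
  obtains x :: "'n \<Rightarrow> 'm \<Rightarrow> real" and \<phi> where "\<And>k i. 0 \<le> x k i" "\<And>k. (\<Sum>i\<in>UNIV. x k i) = 1"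
    "\<And>k j. W + \<phi> k \<le> (\<Sum>i\<in>UNIV. x k i * A $ i $ j) + c * S $ k $ j + \<phi> j"
  using assms unfolding certified_def by blast

lemma certified_convex:
  fixes A :: "real^'n::finite^'m::finite"
  assumes "certified A S c W" "certified A S c' W'" and u: "0 \<le> u" "0 \<le> v" "u + v = 1"
  shows "certified A S (u * c + v * c') (u * W + v * W')"
proof -
  obtain x \<phi> where 1: "\<And>k i. 0 \<le> x k i" "\<And>k. (\<Sum>i\<in>UNIV. x k i) = 1"
    "\<And>k j. W + \<phi> k \<le> (\<Sum>i\<in>UNIV. x k i * A $ i $ j) + c * S $ k $ j + \<phi> j"
    using certifiedE[OF assms(1)] by blast
  obtain x' \<phi>' where 2: "\<And>k i. 0 \<le> x' k i" "\<And>k. (\<Sum>i\<in>UNIV. x' k i) = 1"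
    "\<And>k j. W' + \<phi>' k \<le> (\<Sum>i\<in>UNIV. x' k i * A $ i $ j) + c' * S $ k $ j + \<phi>' j"
    using certifiedE[OF assms(2)] by blast
  show ?thesis
  proof (rule certifiedI)
    show "0 \<le> u * x k i + v * x' k i" for k i using u 1(1) 2(1) by simp
    show "(\<Sum>i\<in>UNIV. u * x k i + v * x' k i) = 1" for k
      using u(3) by (simp add: sum.distrib sum_distrib_left[symmetric] 1(2) 2(2))
    show "u * W + v * W' + (u * \<phi> k + v * \<phi>' k) \<le> (\<Sum>i\<in>UNIV. (u * x k i + v * x' k i) * A $ i $ j)
        + (u * c + v * c') * S $ k $ j + (u * \<phi> j + v * \<phi>' j)" for k j
    proof -
      have "(\<Sum>i\<in>UNIV. (u * x k i + v * x' k i) * A $ i $ j) =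
          u * (\<Sum>i\<in>UNIV. x k i * A $ i $ j) + v * (\<Sum>i\<in>UNIV. x' k i * A $ i $ j)"
        by (simp add: distrib_right sum.distrib sum_distrib_left mult.assoc)
      then show ?thesis
        using mult_left_mono[OF 1(3)[of k j] u(1)] mult_left_mono[OF 2(3)[of k j] u(2)]
        by (simp add: algebra_simps)
    qed
  qed
qed

lemma certified_change_cost:
  fixes A :: "real^'n::finite^'m::finite"
  assumes "certified A S c W" "\<And>k j. W' - W \<le> (c' - c) * S $ k $ j"
  shows "certified A S c' W'"
proof -
  obtain x \<phi> where 1: "\<And>k i. 0 \<le> x k i" "\<And>k. (\<Sum>i\<in>UNIV. x k i) = 1"
    "\<And>k j. W + \<phi> k \<le> (\<Sum>i\<in>UNIV. x k i * A $ i $ j) + c * S $ k $ j + \<phi> j"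
    using certifiedE[OF assms(1)] by blast
  have "W' + \<phi> k \<le> (\<Sum>i\<in>UNIV. x k i * A $ i $ j) + c' * S $ k $ j + \<phi> j" for k j
    using 1(3)[of k j] assms(2)[of k j] by (simp add: algebra_simps)
  with 1 show ?thesis by (intro certifiedI[of x])
qed

text \<open>
  Strong duality in the form of an alternative. If no certificate exists, the convex set of slack
  matrices \<open>slack x \<phi>\<close> misses the open positive orthant, and a hyperplane with normal \<open>q\<close> separates
  the two. The orthant forces \<open>q \<ge> 0\<close>. The potential \<open>\<phi>\<close> is unrestricted, which forces \<open>q\<close> to be a
  circulation: inflow equals outflow at every action. Normalized, a circulation is an invariant
  distribution \<open>\<pi>\<close> with transition law \<open>p\<close>, and the separation inequality at pure replies is the
  bound on the payoff.
\<close>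

lemma stationary_if_not_certified:
  fixes A :: "real^'n::finite^'m::finite" and S :: "real^'n^'n"
  assumes "\<not> certified A S c W"
  obtains \<pi> p where "bind_pmf \<pi> p = \<pi>"
    "\<And>\<rho> :: 'n \<Rightarrow> 'm. (\<Sum>k\<in>UNIV. \<Sum>j\<in>UNIV. pmf \<pi> k * pmf (p k) j * (A $ \<rho> k $ j + c * S $ k $ j)) \<le> W"
proof -
  define slack :: "('n \<Rightarrow> 'm \<Rightarrow> real) \<Rightarrow> ('n \<Rightarrow> real) \<Rightarrow> real^'n^'n" where
    "slack x \<phi> = (\<chi> k j. (\<Sum>i\<in>UNIV. x k i * A $ i $ j) + c * S $ k $ j + \<phi> j - \<phi> k - W)" for x \<phi>
  define D where "D = {slack x \<phi> | x \<phi>. (\<forall>k i. 0 \<le> x k i) \<and> (\<forall>k. (\<Sum>i\<in>UNIV. x k i) = 1)}"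
  define T where "T = {d :: real^'n^'n. \<forall>k j. 0 < d $ k $ j}"
  define det :: "('n \<Rightarrow> 'm) \<Rightarrow> 'n \<Rightarrow> 'm \<Rightarrow> real" where "det \<rho> k i = (if i = \<rho> k then 1 else 0)" for \<rho> k i
  have pure: "slack (det \<rho>) \<phi> \<in> D" for \<rho> \<phi>
    unfolding D_def by (intro CollectI exI conjI refl) (auto simp: det_def[abs_def])
  have slack_pure: "slack (det \<rho>) \<phi> $ k $ j = A $ \<rho> k $ j + c * S $ k $ j + \<phi> j - \<phi> k - W" for \<rho> \<phi> k j
    by (simp add: slack_def det_def if_distrib[of "\<lambda>x. x * _"] cong: if_cong)
  have "convex D"
  proof (rule convexI)
    fix d d' and u v :: real assume "d \<in> D" "d' \<in> D" and u: "0 \<le> u" "0 \<le> v" "u + v = 1"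
    then obtain x \<phi> x' \<phi>' where d: "d = slack x \<phi>" "\<forall>k i. 0 \<le> x k i" "\<forall>k. (\<Sum>i\<in>UNIV. x k i) = 1"
      and d': "d' = slack x' \<phi>'" "\<forall>k i. 0 \<le> x' k i" "\<forall>k. (\<Sum>i\<in>UNIV. x' k i) = 1"
      unfolding D_def by blast
    have cS: "c * S $ k $ j = u * (c * S $ k $ j) + v * (c * S $ k $ j)" for k j
      using u(3) by (metis distrib_right mult_1)
    have W: "W = u * W + v * W" using u(3) by (metis distrib_right mult_1)
    have "u *\<^sub>R d + v *\<^sub>R d' = slack (\<lambda>k i. u * x k i + v * x' k i) (\<lambda>k. u * \<phi> k + v * \<phi>' k)"
      unfolding vec_eq_iff d d' slack_def
      by (subst (2) W, subst (3) cS)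
        (simp add: algebra_simps sum.distrib sum_distrib_left)
    moreover have "\<forall>k i. 0 \<le> u * x k i + v * x' k i" "\<forall>k. (\<Sum>i\<in>UNIV. u * x k i + v * x' k i) = 1"
      using d d' u by (simp_all add: sum.distrib sum_distrib_left[symmetric])
    ultimately show "u *\<^sub>R d + v *\<^sub>R d' \<in> D"
      unfolding D_def by blast
  qed
  moreover have "convex T"
  proof (rule convexI)
    fix d d' and u v :: real assume d: "d \<in> T" "d' \<in> T" and u: "0 \<le> u" "0 \<le> v" "u + v = 1"
    have "0 < u * d $ k $ j + v * d' $ k $ j" for k j
    proof (cases "u = 0")
      case False
      have pos: "0 < d $ k $ j" "0 < d' $ k $ j" using d by (auto simp: T_def)
      with False u show ?thesis
        by (intro add_pos_nonneg mult_pos_pos mult_nonneg_nonneg) auto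
    qed (use d u in \<open>simp add: T_def\<close>)
    then show "u *\<^sub>R d + v *\<^sub>R d' \<in> T" by (simp add: T_def)
  qed
  moreover have "D \<noteq> {}" using pure by blast
  moreover have "T \<noteq> {}"
  proof -
    have "(\<chi> k j. 1) \<in> T" by (simp add: T_def)
    then show ?thesis by blast
  qed
  moreover have "D \<inter> T = {}"
  proof (rule ccontr)
    assume "D \<inter> T \<noteq> {}"
    then obtain x \<phi> where x: "\<forall>k i. 0 \<le> x k i" "\<forall>k. (\<Sum>i\<in>UNIV. x k i) = 1" "slack x \<phi> \<in> T"
      unfolding D_def by blast
    have "W + \<phi> k \<le> (\<Sum>i\<in>UNIV. x k i * A $ i $ j) + c * S $ k $ j + \<phi> j" for k j
    proof -
      have "0 < slack x \<phi> $ k $ j" using x(3) by (simp add: T_def)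
      then show ?thesis by (simp add: slack_def)
    qed
    then have "certified A S c W" using x(1,2) by (intro certifiedI[of x]) auto
    with assms show False by blast
  qed
  ultimately obtain a b where "a \<noteq> 0" and aD: "\<forall>d\<in>D. inner a d \<le> b" and aT: "\<forall>d\<in>T. b \<le> inner a d"
    using separating_hyperplane_sets[of D T] by blast
  define q where "q k j = a $ k $ j" for k j
  define Q where "Q = (\<Sum>k\<in>UNIV. \<Sum>j\<in>UNIV. q k j)"
  have inner: "inner a d = (\<Sum>k\<in>UNIV. \<Sum>j\<in>UNIV. q k j * d $ k $ j)" for d
    by (simp add: inner_vec_def q_def)
  have q_nonneg: "0 \<le> q k0 j0" for k0 j0
  proof (rule ccontr)
    assume "\<not> 0 \<le> q k0 j0"
    \<comment> \<open>Inflating the entry of the orthant point at a negative coefficient drives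
      the inner product below \<open>b\<close>.\<close>
    define t where "t = (\<bar>Q\<bar> + \<bar>b\<bar> + 1) / - q k0 j0"
    have t: "0 < t" "t * q k0 j0 = - (\<bar>Q\<bar> + \<bar>b\<bar> + 1)"
      using \<open>\<not> 0 \<le> q k0 j0\<close> by (simp_all add: t_def field_simps)
    let ?d = "(\<chi> k j. 1 + (if k = k0 then if j = j0 then t else 0 else 0)) :: real^'n^'n"
    have "?d \<in> T" using t(1) by (simp add: T_def)
    then have "b \<le> inner a ?d" using aT by blast
    also have "\<dots> = Q + (\<Sum>k\<in>UNIV. \<Sum>j\<in>UNIV. if k = k0 then if j = j0 then q k j * t else 0 else 0)"
      unfolding inner Q_def sum.distrib[symmetric] by (intro sum.cong refl) (simp add: distrib_left)
    also have "(\<Sum>k\<in>UNIV. \<Sum>j\<in>UNIV. if k = k0 then if j = j0 then q k j * t else 0 else 0) = q k0 j0 * t"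
    proof -
      have "(\<Sum>j\<in>UNIV. if k = k0 then if j = j0 then q k j * t else 0 else 0) = (if k = k0 then q k j0 * t else 0)" for k
        by simp
      then show ?thesis by simp
    qed
    finally show False using t(2) by (simp add: mult.commute)
  qed
  have b: "b \<le> 0"
  proof (rule ccontr)
    assume "\<not> b \<le> 0"
    have const: "b \<le> e * Q" if "0 < e" for e
    proof -
      have "(\<chi> k j. e) \<in> T" using that by (simp add: T_def)
      then have "b \<le> inner a (\<chi> k j. e)" using aT by blast
      then show ?thesis by (simp add: inner Q_def sum_distrib_left mult.commute)
    qed
    have "0 < Q" using const[of 1] \<open>\<not> b \<le> 0\<close> by simp
    then show False using const[of "b / (2 * Q)"] \<open>\<not> b \<le> 0\<close> by simp
  qed
  have Q: "0 < Q"
  proof -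
    obtain k j where "q k j \<noteq> 0" using \<open>a \<noteq> 0\<close> unfolding vec_eq_iff q_def by auto
    then have "0 < q k j" using q_nonneg[of k j] by simp
    also have "\<dots> \<le> (\<Sum>j\<in>UNIV. q k j)" by (rule member_le_sum) (auto simp: q_nonneg)
    also have "\<dots> \<le> Q" unfolding Q_def by (rule member_le_sum) (auto simp: q_nonneg sum_nonneg)
    finally show ?thesis .
  qed
  have key: "(\<Sum>k\<in>UNIV. \<Sum>j\<in>UNIV. q k j * (A $ \<rho> k $ j + c * S $ k $ j + \<phi> j - \<phi> k - W)) \<le> 0" for \<rho> \<phi>
    using aD pure[of \<rho> \<phi>] b unfolding inner slack_pure[symmetric] by force
  have balance: "(\<Sum>k\<in>UNIV. q k l) = (\<Sum>j\<in>UNIV. q l j)" for l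
  proof (rule ccontr)
    define \<delta> where "\<delta> = (\<Sum>k\<in>UNIV. q k l) - (\<Sum>j\<in>UNIV. q l j)"
    assume "\<not> ?thesis"
    then have \<delta>: "\<delta> \<noteq> 0" by (simp add: \<delta>_def)
    define R where "R = (\<Sum>k\<in>UNIV. \<Sum>j\<in>UNIV. q k j * (A $ undefined $ j + c * S $ k $ j - W))"
    \<comment> \<open>A potential concentrated on an unbalanced action, scaled so as to
      violate the separation inequality.\<close>
    define t where "t = (\<bar>R\<bar> + 1) / \<delta>"
    define \<phi> where "\<phi> k = (if k = l then t else 0)" for k
    have "(\<Sum>k\<in>UNIV. \<Sum>j\<in>UNIV. q k j * (A $ undefined $ j + c * S $ k $ j + \<phi> j - \<phi> k - W)) =
        (\<Sum>k\<in>UNIV. \<Sum>j\<in>UNIV. q k j * (A $ undefined $ j + c * S $ k $ j - W) + (q k j * \<phi> j - q k j * \<phi> k))"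
      by (intro sum.cong refl) (simp add: algebra_simps)
    also have "\<dots> = R + ((\<Sum>k\<in>UNIV. \<Sum>j\<in>UNIV. q k j * \<phi> j) - (\<Sum>k\<in>UNIV. (\<Sum>j\<in>UNIV. q k j) * \<phi> k))"
      by (simp add: sum.distrib sum_subtractf R_def sum_distrib_right)
    also have "\<dots> = R + t * \<delta>"
      by (simp add: \<phi>_def \<delta>_def if_distrib[of "\<lambda>x. _ * x"] sum_distrib_left right_diff_distrib mult.commute cong: if_cong)
    finally have "R + t * \<delta> \<le> 0" using key[of "\<lambda>_. undefined" \<phi>] by simp
    moreover have "t * \<delta> = \<bar>R\<bar> + 1" using \<delta> by (simp add: t_def)
    ultimately show False by linarith
  qed
  obtain \<pi> where \<pi>: "\<And>k. pmf \<pi> k = (\<Sum>j\<in>UNIV. q k j) / Q"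
    using Q by (rule_tac ex_pmf_finite[of "\<lambda>k. (\<Sum>j\<in>UNIV. q k j) / Q"])
      (auto simp: sum_nonneg q_nonneg Q_def sum_divide_distrib[symmetric])
  \<comment> \<open>The transition law out of an action of probability \<open>0\<close> is arbitrary.\<close>
  have "\<exists>r. \<forall>j. pmf \<pi> k * pmf r j = q k j / Q" for k
  proof (cases "(\<Sum>j\<in>UNIV. q k j) = 0")
    case True
    then have "q k j = 0" for j by (simp add: sum_nonneg_eq_0_iff q_nonneg)
    then show ?thesis by (simp add: \<pi>)
  next
    case False
    then have pos: "0 < (\<Sum>j\<in>UNIV. q k j)" using sum_nonneg[of UNIV "q k"] q_nonneg by fastforce
    obtain r where r: "\<And>j. pmf r j = q k j / (\<Sum>j\<in>UNIV. q k j)"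
      using pos by (rule_tac ex_pmf_finite[of "\<lambda>j. q k j / (\<Sum>j\<in>UNIV. q k j)"])
        (auto simp: q_nonneg sum_divide_distrib[symmetric])
    have "pmf \<pi> k * pmf r j = q k j / Q" for j using False by (simp add: \<pi> r)
    then show ?thesis by blast
  qed
  then obtain p where p: "\<And>k j. pmf \<pi> k * pmf (p k) j = q k j / Q" by metis
  show thesis
  proof
    show "bind_pmf \<pi> p = \<pi>"
    proof (rule pmf_eqI)
      fix j
      have "pmf (bind_pmf \<pi> p) j = (\<Sum>k\<in>UNIV. pmf \<pi> k * pmf (p k) j)"
        by (simp add: pmf_bind expectation_finite)
      also have "\<dots> = (\<Sum>k\<in>UNIV. q k j) / Q" by (simp only: p sum_divide_distrib)
      finally show "pmf (bind_pmf \<pi> p) j = pmf \<pi> j" by (simp only: balance \<pi>)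
    qed
    fix \<rho> :: "'n \<Rightarrow> 'm"
    have "(\<Sum>k\<in>UNIV. \<Sum>j\<in>UNIV. q k j * (A $ \<rho> k $ j + c * S $ k $ j)) - W * Q \<le> 0"
      using key[of \<rho> "\<lambda>_. 0"] by (simp add: right_diff_distrib sum_subtractf Q_def sum_distrib_left mult.commute)
    then show "(\<Sum>k\<in>UNIV. \<Sum>j\<in>UNIV. pmf \<pi> k * pmf (p k) j * (A $ \<rho> k $ j + c * S $ k $ j)) \<le> W"
      using Q by (simp add: p sum_divide_distrib[symmetric] divide_le_eq)
  qed
qed

section \<open>The value and its dependence on the cost\<close>

context nonneg_game
begin

text \<open>
  After every nonempty history Player 1 plays the certified reply to the last action of Player 2.
  The inequality holds for each pure action of Player 2, hence for each mixed one.
\<close>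

lemma certified_guarantee:
  assumes "0 \<le> c" "certified A S c W"
  obtains \<sigma> where "\<And>\<tau>. W \<le> payoff A S c \<sigma> \<tau>"
proof -
  obtain x \<phi> where x: "\<And>k i. 0 \<le> x k i" "\<And>k. (\<Sum>i\<in>UNIV. x k i) = 1"
    and \<phi>: "\<And>k j. W + \<phi> k \<le> (\<Sum>i\<in>UNIV. x k i * A $ i $ j) + c * S $ k $ j + \<phi> j"
    using certifiedE[OF assms(2)] by blast
  have "\<exists>r. \<forall>i. pmf r i = x k i" for k
    using ex_pmf_finite[of "x k"] x by metis
  then obtain X where X: "\<And>k i. pmf (X k) i = x k i" by metis
  show thesis
  proof
    fix \<tau>
    show "W \<le> payoff A S c (\<lambda>h. X (snd (last h))) \<tau>"
    proof (rule payoff_ge_potential[OF assms(1)])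
      fix h :: "('m, 'n) history" assume h: "h \<noteq> []"
      let ?k = "snd (last h)"
      have swap: "measure_pmf.expectation (pair_pmf (X ?k) (\<tau> h)) (\<lambda>a. round_payoff A S c h a + \<phi> (snd a)) =
        measure_pmf.expectation (\<tau> h) (\<lambda>j. measure_pmf.expectation (X ?k)
          (\<lambda>i. A $ i $ j + (c * S $ ?k $ j + \<phi> j)))"
      proof -
        have "measure_pmf.expectation (pair_pmf (X ?k) (\<tau> h)) (\<lambda>a. round_payoff A S c h a + \<phi> (snd a)) =
          (\<Sum>i\<in>UNIV. \<Sum>j\<in>UNIV. pmf (X ?k) i * (pmf (\<tau> h) j * (A $ i $ j + (c * S $ ?k $ j + \<phi> j))))"
          using h unfolding expectation_pair_finite
          by (simp only: expectation_finite round_payoff_def sum_distrib_left) (simp add: add.assoc)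
        also have "\<dots> = (\<Sum>j\<in>UNIV. \<Sum>i\<in>UNIV. pmf (\<tau> h) j * (pmf (X ?k) i * (A $ i $ j + (c * S $ ?k $ j + \<phi> j))))"
          by (subst sum.swap) (simp add: mult.left_commute)
        finally show ?thesis by (simp add: expectation_finite sum_distrib_left)
      qed
      have "W + \<phi> ?k = measure_pmf.expectation (\<tau> h) (\<lambda>j. W + \<phi> ?k)" by simp
      also have "\<dots> \<le> measure_pmf.expectation (\<tau> h) (\<lambda>j. measure_pmf.expectation (X ?k)
          (\<lambda>i. A $ i $ j + (c * S $ ?k $ j + \<phi> j)))"
      proof (rule integral_mono)
        fix j
        have "W + \<phi> ?k \<le> measure_pmf.expectation (X ?k) (\<lambda>i. A $ i $ j) + (c * S $ ?k $ j + \<phi> j)"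
          using \<phi>[of ?k j] by (simp add: expectation_finite X)
        then show "W + \<phi> ?k \<le> measure_pmf.expectation (X ?k) (\<lambda>i. A $ i $ j + (c * S $ ?k $ j + \<phi> j))"
          by simp
      qed simp_all
      finally show "W + \<phi> ?k \<le> measure_pmf.expectation (pair_pmf (X ?k) (\<tau> h)) (\<lambda>a. round_payoff A S c h a + \<phi> (snd a))"
        unfolding swap .
    qed
  qed
qed

lemma uncertified_guarantee:
  assumes "0 \<le> c" "\<not> certified A S c W"
  obtains \<tau> where "\<And>\<sigma>. payoff A S c \<sigma> \<tau> \<le> W"
proof -
  obtain \<pi> p where inv: "bind_pmf \<pi> p = \<pi>"
    and le: "\<And>\<rho> :: 'n \<Rightarrow> 'm. (\<Sum>k\<in>UNIV. \<Sum>j\<in>UNIV. pmf \<pi> k * pmf (p k) j * (A $ \<rho> k $ j + c * S $ k $ j)) \<le> W"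
    using stationary_if_not_certified[OF assms(2)] by blast
  define f where "f k i = measure_pmf.expectation (p k) (\<lambda>j. A $ i $ j + c * S $ k $ j)" for k i
  have "\<exists>i. \<forall>i'. f k i' \<le> f k i" for k
  proof -
    have "Max (range (f k)) \<in> range (f k)" by (rule Max_in) auto
    then obtain i where i: "Max (range (f k)) = f k i" by blast
    have "f k i' \<le> f k i" for i' unfolding i[symmetric] by (rule Max_ge) auto
    then show ?thesis by blast
  qed
  then obtain \<rho> where \<rho>: "\<And>k i. f k i \<le> f k (\<rho> k)" by metis
  have "measure_pmf.expectation \<pi> (\<lambda>k. f k (\<rho> k)) \<le> W"
    using le[of \<rho>] by (simp add: f_def expectation_finite sum_distrib_left mult.assoc)
  then have "payoff A S c \<sigma> (stationary_strategy \<pi> p) \<le> W" for \<sigma>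
    using \<rho> by (intro payoff_stationary_le[OF assms(1) inv, of "\<lambda>k. f k (\<rho> k)"]) (simp_all add: f_def[symmetric])
  then show thesis by (rule that)
qed

text \<open>
  Weak duality and the alternative leave no gap between the two iterated extrema: below the upper
  value there are certificates, and certificates bound the lower value from below. Hence the value
  exists, and it is the supremum of the certified numbers.
\<close>

lemma game_value_properties:
  assumes "0 \<le> c"
  shows "certified A S c W \<Longrightarrow> W \<le> game_value A S c"
    and "W < game_value A S c \<Longrightarrow> certified A S c W"
    and "(\<And>\<sigma>. payoff A S c \<sigma> \<tau> \<le> W) \<Longrightarrow> game_value A S c \<le> W"
proof -
  let ?L = "SUP \<sigma>. INF \<tau>. payoff A S c \<sigma> \<tau>" and ?U = "INF \<tau>. SUP \<sigma>. payoff A S c \<sigma> \<tau>"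
  obtain K where K: "\<And>\<sigma> \<tau>. 0 \<le> payoff A S c \<sigma> \<tau>" "\<And>\<sigma> \<tau>. payoff A S c \<sigma> \<tau> \<le> K"
    using payoff_bounds[OF assms] by blast
  have inner_inf: "bdd_below (range (\<lambda>\<tau>. payoff A S c \<sigma> \<tau>))" for \<sigma> using K(1) by (intro bdd_belowI2)
  have inner_sup: "bdd_above (range (\<lambda>\<sigma>. payoff A S c \<sigma> \<tau>))" for \<tau> using K(2) by (intro bdd_aboveI2)
  have inf_le: "(INF \<tau>. payoff A S c \<sigma> \<tau>) \<le> payoff A S c \<sigma> \<tau>" for \<sigma> \<tau>
    by (intro cINF_lower inner_inf) simp
  have le_sup: "payoff A S c \<sigma> \<tau> \<le> (SUP \<sigma>. payoff A S c \<sigma> \<tau>)" for \<sigma> \<tau>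
    by (intro cSUP_upper inner_sup) simp
  have outer_sup: "bdd_above (range (\<lambda>\<sigma>. INF \<tau>. payoff A S c \<sigma> \<tau>))"
    using inf_le K(2) by (intro bdd_aboveI2[where M = K]) (meson order_trans)
  have outer_inf: "bdd_below (range (\<lambda>\<tau>. SUP \<sigma>. payoff A S c \<sigma> \<tau>))"
    using le_sup K(1) by (intro bdd_belowI2[where m = 0]) (meson order_trans)
  have weak: "?L \<le> ?U"
    by (intro cSUP_least cINF_greatest) (auto intro: order_trans[OF inf_le le_sup])
  have upper: "?U \<le> W" if "\<And>\<sigma>. payoff A S c \<sigma> \<tau> \<le> W" for \<tau> W
  proof -
    have "?U \<le> (SUP \<sigma>. payoff A S c \<sigma> \<tau>)" by (intro cINF_lower outer_inf) simp
    also have "\<dots> \<le> W" using that by (intro cSUP_least) auto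
    finally show ?thesis .
  qed
  have lower: "W \<le> ?L" if W: "certified A S c W" for W
  proof -
    obtain \<sigma> where "\<And>\<tau>. W \<le> payoff A S c \<sigma> \<tau>" using certified_guarantee[OF assms W] by blast
    then have "W \<le> (INF \<tau>. payoff A S c \<sigma> \<tau>)" by (intro cINF_greatest) auto
    also have "\<dots> \<le> ?L" by (intro cSUP_upper outer_sup) simp
    finally show ?thesis .
  qed
  have below: "certified A S c W" if "W < ?U" for W
    using uncertified_guarantee[OF assms, of W] upper that by (meson not_less)
  have "?L = ?U"
  proof (rule antisym[OF weak], rule dense_le)
    fix W assume "W < ?U"
    then show "W \<le> ?L" by (intro lower below)
  qed
  then have "game_value A S c = ?U" unfolding game_value_def is_game_value_def
    by (intro the_equality) auto
  note gv = this
  show "W \<le> game_value A S c" if "certified A S c W"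
    using lower[OF that] unfolding gv \<open>?L = ?U\<close> .
  show "certified A S c W" if "W < game_value A S c"
    using that unfolding gv by (rule below)
  show "game_value A S c \<le> W" if "\<And>\<sigma>. payoff A S c \<sigma> \<tau> \<le> W"
    unfolding gv using that by (rule upper)
qed

text \<open>
  Convex combinations of certificates for \<open>c\<close> and \<open>c'\<close> are certificates for the combined cost.
\<close>

lemma game_value_concave:
  assumes "0 \<le> c" "0 \<le> c'" "0 \<le> u" "0 \<le> v" "u + v = 1"
  shows "u * game_value A S c + v * game_value A S c' \<le> game_value A S (u * c + v * c')"
proof (rule field_le_epsilon)
  fix e :: real assume "0 < e"
  have "certified A S (u * c + v * c') (u * (game_value A S c - e) + v * (game_value A S c' - e))"
    using assms \<open>0 < e\<close> by (intro certified_convex game_value_properties(2)) auto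
  then have "u * (game_value A S c - e) + v * (game_value A S c' - e) \<le> game_value A S (u * c + v * c')"
    using assms by (intro game_value_properties(1)) auto
  moreover have "u * e + v * e = e" using assms(5) by (metis distrib_right mult_1)
  ultimately show "u * game_value A S c + v * game_value A S c' \<le> game_value A S (u * c + v * c') + e"
    by (simp add: right_diff_distrib)
qed

text \<open>
  A certificate survives a change of cost if its level moves by at most the least change of any
  switching cost. With \<open>d = 0\<close> this is monotonicity in the cost, with negative \<open>d\<close> a Lipschitz
  bound.
\<close>

lemma game_value_change_cost:
  assumes "0 \<le> c" "0 \<le> c'" "\<And>k j. d \<le> (c' - c) * S $ k $ j"
  shows "game_value A S c + d \<le> game_value A S c'"
proof (rule field_le_epsilon)
  fix e :: real assume "0 < e"
  then have "certified A S c (game_value A S c - e)"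
    using assms(1) by (intro game_value_properties(2)) auto
  then have "certified A S c' (game_value A S c + d - e)"
    using assms(3) by (elim certified_change_cost) simp
  then have "game_value A S c + d - e \<le> game_value A S c'"
    using assms(2) by (intro game_value_properties(1))
  then show "game_value A S c + d \<le> game_value A S c' + e" by simp
qed

end

section \<open>Static strategies\<close>

abbreviation worst_case :: "real^'n::finite^'m::finite \<Rightarrow> 'n pmf \<Rightarrow> real" where
  "worst_case A y \<equiv> SUP x. bilin A x y"

lemma bilin_return: "bilin A (return_pmf i) y = measure_pmf.expectation y (\<lambda>j. A $ i $ j)"
proof -
  have "bilin A (return_pmf i) y = (\<Sum>i'\<in>UNIV. if i' = i then \<Sum>j\<in>UNIV. A $ i' $ j * pmf y j else 0)"
    unfolding bilin_def by (intro sum.cong refl) (auto simp: indicator_def)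
  then show ?thesis by (simp add: expectation_finite mult.commute)
qed

lemma bilin_eq_expectation: "bilin A x y = measure_pmf.expectation x (\<lambda>i. bilin A (return_pmf i) y)"
  unfolding bilin_return expectation_finite by (simp add: bilin_def sum_distrib_left mult_ac)

text \<open>
  The supremum over mixed rows is attained at a pure row; the additive constant \<open>k\<close> accommodates the
  switching cost in \<open>static_value\<close>.
\<close>

lemma worst_case_row:
  fixes A :: "real^'n::finite^'m::finite"
  obtains i where "\<And>k. (SUP x. bilin A x y + k) = bilin A (return_pmf i) y + k"
    "worst_case A y = bilin A (return_pmf i) y" "\<And>x. bilin A x y \<le> bilin A (return_pmf i) y"
proof -
  have "Max (range (\<lambda>i. bilin A (return_pmf i) y)) \<in> range (\<lambda>i. bilin A (return_pmf i) y)" by (rule Max_in) auto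
  then obtain i where i: "Max (range (\<lambda>i. bilin A (return_pmf i) y)) = bilin A (return_pmf i) y" by blast
  have "bilin A (return_pmf i') y \<le> bilin A (return_pmf i) y" for i'
    unfolding i[symmetric] by (rule Max_ge) auto
  then have "bilin A x y \<le> measure_pmf.expectation x (\<lambda>_. bilin A (return_pmf i) y)" for x
    unfolding bilin_eq_expectation[of A x y] by (intro integral_mono integrable_finite_pmf)
  then have le: "bilin A x y \<le> bilin A (return_pmf i) y" for x by simp
  have sup: "(SUP x. bilin A x y + k) = bilin A (return_pmf i) y + k" for k
    by (rule cSup_eq_maximum) (auto simp: le)
  show thesis using that[OF sup _ le] sup[of 0] by simp
qed

lemma bilin_le_worst_case: "bilin A x y \<le> worst_case A y"
  by (rule worst_case_row[of A y]) simp

lemma static_value_eq: "static_value A S c = (INF y. worst_case A y + c * bilin S y y)"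
proof -
  have "(SUP x. bilin A x y + c * bilin S y y) = worst_case A y + c * bilin S y y" for y
    by (rule worst_case_row[of A y]) simp
  then show ?thesis by (simp add: static_value_def)
qed

lemma worst_case_return: "worst_case A (return_pmf j) = (MAX i. A $ i $ j)"
proof -
  obtain i where i: "worst_case A (return_pmf j) = bilin A (return_pmf i) (return_pmf j)"
    "\<And>x. bilin A x (return_pmf j) \<le> bilin A (return_pmf i) (return_pmf j)"
    using worst_case_row[of A "return_pmf j"] by metis
  have "A $ i' $ j \<le> A $ i $ j" for i' using i(2)[of "return_pmf i'"] by (simp add: bilin_return)
  then have "Max (range (\<lambda>i. A $ i $ j)) = A $ i $ j" by (intro Max_eqI) auto
  then show ?thesis using i(1) by (simp add: bilin_return)
qed

lemma pure_minimax_attained: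
  fixes A :: "real^'n::finite^'m::finite"
  obtains j where "(MAX i. A $ i $ j) = pure_minimax A"
proof -
  have "Min (range (\<lambda>j. MAX i. A $ i $ j)) \<in> range (\<lambda>j. MAX i. A $ i $ j)" by (rule Min_in) auto
  then show thesis using that unfolding pure_minimax_def by force
qed

lemma pure_minimax_le: "pure_minimax A \<le> (MAX i. A $ i $ j)"
  for A :: "real^'n::finite^'m::finite"
  unfolding pure_minimax_def by (rule Min_le) auto

context nonneg_game
begin

lemma bilin_nonneg: "0 \<le> bilin A x y" "0 \<le> bilin S z z"
  unfolding bilin_def by (auto intro!: sum_nonneg mult_nonneg_nonneg simp: A_nonneg S_nonneg)

lemma one_shot_value_le: "one_shot_value A \<le> worst_case A y"
  unfolding one_shot_value_def
proof (rule cINF_lower)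
  show "bdd_below (range (worst_case A))"
    by (rule bdd_belowI2[where m = 0]) (rule order_trans[OF bilin_nonneg(1) bilin_le_worst_case])
qed simp

lemma static_value_le:
  assumes "0 \<le> c"
  shows "static_value A S c \<le> worst_case A y + c * bilin S y y"
  unfolding static_value_eq
proof (rule cINF_lower)
  show "bdd_below (range (\<lambda>y. worst_case A y + c * bilin S y y))"
    using assms by (intro bdd_belowI2[where m = 0] add_nonneg_nonneg mult_nonneg_nonneg bilin_nonneg)
      (rule order_trans[OF bilin_nonneg(1) bilin_le_worst_case])
qed simp

lemma static_value_zero: "static_value A S 0 = one_shot_value A"
  by (simp add: static_value_eq one_shot_value_def)

lemma payoff_static_le:
  assumes "0 \<le> c"
  shows "payoff A S c \<sigma> (static_strategy y) \<le> worst_case A y + c * bilin S y y"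
  unfolding static_eq_stationary
proof (rule payoff_stationary_le[OF assms, where g = "\<lambda>k. worst_case A y + c * bilin S (return_pmf k) y"])
  show "measure_pmf.expectation y (\<lambda>j. A $ i $ j + c * S $ k $ j) \<le> worst_case A y + c * bilin S (return_pmf k) y" for k i
    using bilin_le_worst_case[of A "return_pmf i" y] by (simp add: bilin_return)
  show "measure_pmf.expectation y (\<lambda>k. worst_case A y + c * bilin S (return_pmf k) y) \<le> worst_case A y + c * bilin S y y"
    by (simp add: bilin_eq_expectation[of S y])
qed simp

text \<open>
  Always playing a best row against \<open>y\<close> yields the static payoff. The expected cost of the next
  switch depends on the current action; taken as the potential, it averages out this
  dependence.
\<close>

lemma payoff_static_ge:
  assumes "0 \<le> c"
  obtains \<sigma> where "worst_case A y + c * bilin S y y \<le> payoff A S c \<sigma> (static_strategy y)"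
proof -
  obtain i where i: "worst_case A y = bilin A (return_pmf i) y"
    using worst_case_row[of A y] by metis
  have "worst_case A y + c * bilin S y y \<le> payoff A S c (\<lambda>_. return_pmf i) (static_strategy y)"
  proof (rule payoff_ge_potential[OF assms, where \<phi> = "\<lambda>k. c * bilin S (return_pmf k) y"])
    fix h :: "('m, 'n) history" assume "h \<noteq> []"
    then show "worst_case A y + c * bilin S y y + c * bilin S (return_pmf (snd (last h))) y \<le>
        measure_pmf.expectation (pair_pmf (return_pmf i) (static_strategy y h))
          (\<lambda>a. round_payoff A S c h a + c * bilin S (return_pmf (snd a)) y)"
      unfolding expectation_pair_finite
      by (simp add: round_payoff_def static_strategy_def i bilin_eq_expectation[of S y] bilin_return)
  qed
  then show thesis by (rule that)
qed

lemma game_value_le_static_payoff: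
  "0 \<le> c \<Longrightarrow> game_value A S c \<le> worst_case A y + c * bilin S y y"
  by (rule game_value_properties(3)[OF _ payoff_static_le])

lemma game_value_le_static_value: "0 \<le> c \<Longrightarrow> game_value A S c \<le> static_value A S c"
  unfolding static_value_eq by (intro cINF_greatest game_value_le_static_payoff) auto

text \<open>
  A static strategy is optimal exactly if its worst static payoff does not exceed the value. This
  turns the two thresholds into statements about the value as a function of the cost.
\<close>

lemma optimal2_static_iff:
  assumes "0 \<le> c"
  shows "optimal2 A S c (static_strategy y) \<longleftrightarrow> worst_case A y + c * bilin S y y \<le> game_value A S c"
  unfolding optimal2_def
  using payoff_static_ge[OF assms, of y] payoff_static_le[OF assms, of _ y] by (meson order_trans)

text \<open>
  Without switching costs an invariant distribution of the repeated game is a mixed action of the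
  one-shot game that is at least as good, because Player 1 may ignore the previous action.
\<close>

lemma game_value_zero: "game_value A S 0 = one_shot_value A"
proof (rule antisym)
  show "game_value A S 0 \<le> one_shot_value A"
    using game_value_le_static_value[of 0] by (simp add: static_value_zero)
  show "one_shot_value A \<le> game_value A S 0"
  proof (rule dense_le)
    fix W assume W: "W < one_shot_value A"
    have "certified A S 0 W"
    proof (rule ccontr)
      assume "\<not> certified A S 0 W"
      then obtain \<pi> p where inv: "bind_pmf \<pi> p = \<pi>"
        and le: "\<And>\<rho> :: 'n \<Rightarrow> 'm. (\<Sum>k\<in>UNIV. \<Sum>j\<in>UNIV. pmf \<pi> k * pmf (p k) j * (A $ \<rho> k $ j + 0 * S $ k $ j)) \<le> W"
        by (rule stationary_if_not_certified) blast
      have marginal: "pmf \<pi> j = (\<Sum>k\<in>UNIV. pmf \<pi> k * pmf (p k) j)" for j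
        using arg_cong[OF inv, of "\<lambda>q. pmf q j"] by (simp add: pmf_bind expectation_finite)
      obtain i where i: "worst_case A \<pi> = bilin A (return_pmf i) \<pi>"
        using worst_case_row[of A \<pi>] by metis
      have "bilin A (return_pmf i) \<pi> = (\<Sum>j\<in>UNIV. \<Sum>k\<in>UNIV. pmf \<pi> k * pmf (p k) j * A $ i $ j)"
        by (simp only: bilin_return expectation_finite sum_distrib_right[symmetric] marginal[symmetric])
      also have "\<dots> = (\<Sum>k\<in>UNIV. \<Sum>j\<in>UNIV. pmf \<pi> k * pmf (p k) j * A $ i $ j)" by (rule sum.swap)
      also have "\<dots> \<le> W" using le[of "\<lambda>_. i"] by simp
      finally show False using W one_shot_value_le[of \<pi>] i by simp
    qed
    then show "W \<le> game_value A S 0" by (intro game_value_properties(1)) auto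
  qed
qed

end

section \<open>The two thresholds\<close>

locale positive_switching_game =
  fixes A :: "real^'n::finite^'m::finite" and S :: "real^'n^'n"
  assumes A_range: "0 \<le> A $ i $ j" "A $ i $ j \<le> 1"
    and S_diag: "S $ j $ j = 0" and S_off_diag: "k \<noteq> j \<Longrightarrow> 1 \<le> S $ k $ j"
begin

sublocale nonneg_game A S
proof
  show "0 \<le> S $ k $ j" for k j using S_diag[of j] S_off_diag[of k j] by (cases "k = j") auto
qed (rule A_range)

lemma bilin_S_pure: "bilin S (return_pmf j) (return_pmf j) = 0"
  by (simp add: bilin_return S_diag)

lemma pmf_eq_return_if_bilin_S_zero:
  assumes "bilin S y y = 0"
  obtains j where "y = return_pmf j"
proof -
  obtain j where j: "pmf y j \<noteq> 0" using set_pmf_not_empty[of y] by (auto simp: set_pmf_iff)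
  have zero: "pmf y k = 0" if "k \<noteq> j" for k
  proof -
    have "0 \<le> pmf y k * S $ k $ j * pmf y j" by (simp add: S_nonneg)
    moreover have "pmf y k * S $ k $ j * pmf y j \<le> (\<Sum>j\<in>UNIV. pmf y k * S $ k $ j * pmf y j)"
      by (rule member_le_sum) (auto simp: S_nonneg)
    moreover have "\<dots> \<le> bilin S y y" unfolding bilin_def
      by (rule member_le_sum) (auto simp: S_nonneg sum_nonneg)
    ultimately have "pmf y k * S $ k $ j * pmf y j = 0" using assms by linarith
    then show ?thesis using j S_off_diag[OF that] by auto
  qed
  have "set_pmf y \<subseteq> {j}" using zero by (metis set_pmf_iff singletonI subsetI)
  then show thesis using that by (simp add: set_pmf_subset_singleton)
qed

lemma static_value_le_pure_minimax: "0 \<le> c \<Longrightarrow> static_value A S c \<le> pure_minimax A"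
proof -
  assume c: "0 \<le> c"
  obtain j where "(MAX i. A $ i $ j) = pure_minimax A" by (rule pure_minimax_attained)
  then show ?thesis using static_value_le[OF c, of "return_pmf j"] by (simp add: worst_case_return bilin_S_pure)
qed

text \<open>
  At cost at least \<open>1\<close> a switch costs at least \<open>1\<close>, which no pure minimax value exceeds. So Player 1
  may reply to the previous action as if Player 2 did not switch, with zero potential.
\<close>

lemma pure_minimax_le_game_value:
  assumes "1 \<le> c"
  shows "pure_minimax A \<le> game_value A S c"
proof (rule game_value_properties(1))
  have "\<exists>i. pure_minimax A \<le> A $ i $ j" for j
  proof -
    have "Max (range (\<lambda>i. A $ i $ j)) \<in> range (\<lambda>i. A $ i $ j)" by (rule Max_in) auto
    then show ?thesis using pure_minimax_le[of A j] by force
  qed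
  then obtain r where r: "\<And>j. pure_minimax A \<le> A $ r j $ j" by metis
  have le1: "pure_minimax A \<le> 1" using r[of undefined] A_range(2) by (rule order_trans)
  have row: "(\<Sum>i\<in>UNIV. (if i = r k then 1 else 0) * A $ i $ j) = A $ r k $ j" for k j
    by (simp add: if_distrib[of "\<lambda>x. x * _"] cong: if_cong)
  show "certified A S c (pure_minimax A)"
  proof (rule certifiedI[of "\<lambda>k i. if i = r k then 1 else 0" _ "\<lambda>_. 0"])
    fix k j
    have "pure_minimax A \<le> A $ r k $ j + c * S $ k $ j"
    proof (cases "k = j")
      case True
      then show ?thesis using r[of k] by (simp add: S_diag)
    next
      case False
      have "1 * 1 \<le> c * S $ k $ j" using assms S_off_diag[OF False] by (intro mult_mono) auto
      then show ?thesis using le1 A_range(1)[of "r k" j] by simp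
    qed
    then show "pure_minimax A + 0 \<le> (\<Sum>i\<in>UNIV. (if i = r k then 1 else 0) * A $ i $ j) + c * S $ k $ j + 0"
      unfolding row by simp
  qed simp_all
qed (use assms in simp)

lemma c_upper_properties:
  shows "0 \<le> c_upper A S" and "c_upper A S \<le> c \<Longrightarrow> pure_minimax A \<le> game_value A S c"
proof -
  define U where "U = {d. 0 \<le> d \<and> (\<forall>c\<ge>d. \<exists>j. (MAX i. A $ i $ j) = pure_minimax A \<and>
                    optimal2 A S c (static_strategy (return_pmf j)))}"
  have Inf: "c_upper A S = Inf U" by (simp add: c_upper_def U_def)
  obtain j where j: "(MAX i. A $ i $ j) = pure_minimax A" by (rule pure_minimax_attained)
  have "1 \<in> U" unfolding U_def
  proof (intro CollectI conjI allI impI exI)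
    show "optimal2 A S c (static_strategy (return_pmf j))" if "1 \<le> c" for c
      using pure_minimax_le_game_value[OF that] that j
      by (simp add: optimal2_static_iff worst_case_return bilin_S_pure)
  qed (use j in simp_all)
  then have ne: "U \<noteq> {}" by blast
  show nonneg: "0 \<le> c_upper A S" unfolding Inf using ne by (rule cInf_greatest) (simp add: U_def)
  have above: "pure_minimax A \<le> game_value A S c" if c: "c_upper A S < c" for c
  proof -
    obtain d where d: "d \<in> U" "d < c" using cInf_lessD[OF ne c[unfolded Inf]] by blast
    then have "\<exists>j. (MAX i. A $ i $ j) = pure_minimax A \<and> optimal2 A S c (static_strategy (return_pmf j))"
      by (simp add: U_def)
    then obtain j where "(MAX i. A $ i $ j) = pure_minimax A" "optimal2 A S c (static_strategy (return_pmf j))"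
      by blast
    then show ?thesis using d nonneg c by (simp add: optimal2_static_iff worst_case_return bilin_S_pure)
  qed
  assume c: "c_upper A S \<le> c"
  show "pure_minimax A \<le> game_value A S c"
  proof (rule field_le_epsilon)
    fix e :: real assume "0 < e"
    \<comment> \<open>Right-continuity at the threshold: the value grows at most at rate \<open>B\<close> in
      the cost, so it suffices to look at costs slightly above the threshold.\<close>
    define B where "B = (\<Sum>k\<in>UNIV. \<Sum>j\<in>UNIV. S $ k $ j) + 1"
    have B: "S $ k $ j \<le> B" for k j
    proof -
      have "S $ k $ j \<le> (\<Sum>j\<in>UNIV. S $ k $ j)" by (rule member_le_sum) (auto simp: S_nonneg)
      also have "\<dots> \<le> (\<Sum>k\<in>UNIV. \<Sum>j\<in>UNIV. S $ k $ j)" by (rule member_le_sum) (auto simp: S_nonneg sum_nonneg)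
      finally show ?thesis by (simp add: B_def)
    qed
    have "0 < B" unfolding B_def by (intro add_nonneg_pos sum_nonneg) (auto simp: S_nonneg)
    then have pos: "0 < e / B" using \<open>0 < e\<close> by simp
    have "game_value A S (c + e / B) + - e \<le> game_value A S c"
    proof (rule game_value_change_cost)
      fix k j
      have "e / B * S $ k $ j \<le> e / B * B" using pos B by (intro mult_left_mono) auto
      then show "- e \<le> (c - (c + e / B)) * S $ k $ j" using \<open>0 < B\<close> by simp
    qed (use c nonneg pos in simp_all)
    moreover have "pure_minimax A \<le> game_value A S (c + e / B)" using c pos by (intro above) simp
    ultimately show "pure_minimax A \<le> game_value A S c + e" by simp
  qed
qed

text \<open>
  A static strategy that is optimal on \<open>[0, d]\<close> is in particular optimal at cost \<open>0\<close>, so it belongs to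
  \<open>optimal_mixed A\<close> and its expected switching cost is at least that of \<open>y\<close>. Hence the value lies above
  the line \<open>v + c s\<close> on \<open>[0, d]\<close>. As \<open>v + d s\<close> cannot exceed the pure minimax value, such \<open>d\<close> are
  bounded, and their supremum is a genuine least upper bound.
\<close>

lemma c_lower_properties:
  assumes y: "y \<in> optimal_mixed A" and min: "\<forall>z\<in>optimal_mixed A. bilin S y y \<le> bilin S z z"
    and pos: "0 < bilin S y y"
  shows "0 \<le> c_lower A S"
    and "0 \<le> c \<Longrightarrow> c \<le> c_lower A S \<Longrightarrow> one_shot_value A + c * bilin S y y \<le> game_value A S c"
proof -
  let ?s = "bilin S y y"
  define L where "L = {d. 0 \<le> d \<and> (\<exists>y. \<forall>c\<in>{0..d}. game_value A S c = static_value A S c \<and>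
                         optimal2 A S c (static_strategy y))}"
  have Sup: "c_lower A S = Sup L" by (simp add: c_lower_def L_def)
  have "0 \<in> L" unfolding L_def
  proof (intro CollectI conjI exI ballI)
    fix c :: real assume "c \<in> {0..0}"
    then show "game_value A S c = static_value A S c" "optimal2 A S c (static_strategy y)"
      using y by (simp_all add: game_value_zero static_value_zero optimal2_static_iff optimal_mixed_def)
  qed simp
  have line: "one_shot_value A + c * ?s \<le> game_value A S c" if d: "d \<in> L" "0 \<le> c" "c \<le> d" for c d
  proof -
    obtain z where "\<forall>c\<in>{0..d}. game_value A S c = static_value A S c \<and> optimal2 A S c (static_strategy z)"
      using d(1) unfolding L_def by blast
    then have opt: "optimal2 A S c (static_strategy z)" if "0 \<le> c" "c \<le> d" for c
      using that by simp
    have le: "worst_case A z + c * bilin S z z \<le> game_value A S c" if "0 \<le> c" "c \<le> d" for c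
      using opt[OF that] that by (simp add: optimal2_static_iff)
    have "worst_case A z \<le> one_shot_value A" using le[of 0] d by (simp add: game_value_zero)
    then have z: "z \<in> optimal_mixed A" using one_shot_value_le[of z] by (simp add: optimal_mixed_def)
    have "one_shot_value A + c * ?s \<le> worst_case A z + c * bilin S z z"
      using d(2) by (intro add_mono one_shot_value_le mult_left_mono min[rule_format] z)
    then show ?thesis using le[OF d(2,3)] by simp
  qed
  have bdd: "bdd_above L"
  proof (rule bdd_aboveI)
    fix d assume d: "d \<in> L"
    then have "0 \<le> d" by (simp add: L_def)
    then have "one_shot_value A + d * ?s \<le> pure_minimax A"
      using line[OF d _ order_refl] game_value_le_static_value[of d] static_value_le_pure_minimax[of d] by linarith
    then show "d \<le> (pure_minimax A - one_shot_value A) / ?s" using pos by (simp add: le_divide_eq)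
  qed
  show nonneg: "0 \<le> c_lower A S" unfolding Sup using \<open>0 \<in> L\<close> bdd by (rule cSup_upper)
  assume c: "0 \<le> c" "c \<le> c_lower A S"
  show "one_shot_value A + c * ?s \<le> game_value A S c"
  proof (rule ccontr)
    \<comment> \<open>Beyond \<open>?d\<close> the line exceeds the value at \<open>c\<close>. A cost \<open>b\<close> between \<open>?d\<close> and \<open>c\<close>
      that lies below an element of \<open>L\<close> then contradicts monotonicity.\<close>
    let ?d = "max 0 ((game_value A S c - one_shot_value A) / ?s)"
    assume less: "\<not> ?thesis"
    have "0 \<noteq> c" using less line[OF \<open>0 \<in> L\<close>, of 0] by auto
    moreover have "(game_value A S c - one_shot_value A) / ?s < c" using less pos by (simp add: divide_less_eq)
    ultimately have "?d < c" using c(1) by simp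
    then have "?d < Sup L" using c(2) unfolding Sup by simp
    then obtain d where d: "d \<in> L" "?d < d" using less_cSup_iff[of L ?d] \<open>0 \<in> L\<close> bdd by blast
    define b where "b = min c d"
    have b: "0 \<le> b" "b \<le> d" "b \<le> c" "?d < b" using d(2) \<open>?d < c\<close> c(1) by (auto simp: b_def)
    have "game_value A S b + 0 \<le> game_value A S c"
      using b c(1) by (intro game_value_change_cost) (auto simp: S_nonneg)
    then have "one_shot_value A + b * ?s \<le> game_value A S c" using line[OF d(1) b(1,2)] by simp
    then have "b \<le> (game_value A S c - one_shot_value A) / ?s" using pos by (simp add: le_divide_eq)
    then show False using b(4) by simp
  qed
qed

end

section \<open>The loss from static strategies\<close>

text \<open>
  Between the thresholds the bound is the vertical distance of \<open>min (v + c s) (v + c\<^sub>0 s)\<close>, whose kink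
  is at \<open>c\<^sub>0\<close>, from the chord through its points at \<open>cl\<close> and \<open>cu\<close>.
\<close>

lemma loss_bound_chord:
  assumes order: "cl \<le> c0" "c0 \<le> cu" and "0 \<le> s" "0 \<le> c"
    and static: "w \<le> v + c * s" "w \<le> v + c0 * s"
    and left: "c \<le> cl \<Longrightarrow> v + c * s \<le> g" and right: "cu \<le> c \<Longrightarrow> v + c0 * s \<le> g"
    and chord: "cl < c \<Longrightarrow> c < cu \<Longrightarrow>
      (cu - c) / (cu - cl) * (v + cl * s) + (c - cl) / (cu - cl) * (v + c0 * s) \<le> g"
  shows "w - g \<le> loss_bound cl cu c0 s c"
proof -
  consider "c \<le> cl" | "cu \<le> c" | "cl < c" "c < cu" by linarith
  then show ?thesis
  proof cases
    case 1
    then show ?thesis using left static order by (auto simp: loss_bound_def)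
  next
    case 2
    then have "w \<le> g" using right static by linarith
    moreover have "0 \<le> loss_bound cl cu c0 s c"
      using order \<open>0 \<le> s\<close> by (auto simp: loss_bound_def)
    ultimately show ?thesis by simp
  next
    case 3
    define \<delta> where "\<delta> = cu - cl"
    have \<delta>: "0 < \<delta>" using 3 by (simp add: \<delta>_def)
    have "(cu - c) / \<delta> * (v + cl * s) + (c - cl) / \<delta> * (v + c0 * s) = v + c * s - (c - cl) * ((cu - c0) / \<delta>) * s"
      using \<delta> by (simp add: divide_simps) (simp add: \<delta>_def algebra_simps)
    moreover have "v + c * s - (c - cl) * ((cu - c0) / \<delta>) * s = v + c0 * s - (cu - c) * ((c0 - cl) / \<delta>) * s"
      using \<delta> by (simp add: divide_simps) (simp add: \<delta>_def algebra_simps)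
    moreover note chord[OF 3, folded \<delta>_def]
    moreover have "loss_bound cl cu c0 s c =
        (if c \<le> c0 then (c - cl) * ((cu - c0) / \<delta>) * s else (cu - c) * ((c0 - cl) / \<delta>) * s)"
      using 3 by (simp add: loss_bound_def \<delta>_def)
    ultimately show ?thesis using static by (cases "c \<le> c0") (simp_all only: if_True if_False, linarith+)
  qed
qed

theorem theorem2:
  fixes A :: "real^'n::finite^'m::finite" and S :: "real^'n^'n" and c :: real
    and y :: "'n pmf"
  assumes "switching_game A S c"
    and "\<forall>j. return_pmf j \<notin> optimal_mixed A"
    and "\<forall>k j. k \<noteq> j \<longrightarrow> 0 < S $ k $ j"
    and "is_arg_min (\<lambda>y. bilin S y y) (\<lambda>y. y \<in> optimal_mixed A) y"
  shows "let s = bilin S y y;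
             c0 = (pure_minimax A - one_shot_value A) / s
         in static_value A S c - game_value A S c \<le> loss_bound (c_lower A S) (c_upper A S) c0 s c"
proof -
  interpret positive_switching_game A S
  proof
    show "1 \<le> S $ k $ j" if "k \<noteq> j" for k j
      using assms(1,3) that unfolding switching_game_def by (metis less_irrefl)
  qed (use assms(1) in \<open>simp_all add: switching_game_def\<close>)
  have c: "0 \<le> c" using assms(1) by (simp add: switching_game_def)
  have y: "y \<in> optimal_mixed A" and min: "\<forall>z\<in>optimal_mixed A. bilin S y y \<le> bilin S z z"
    using assms(4) by (auto simp: is_arg_min_def not_less)
  define s where "s = bilin S y y"
  have "s \<noteq> 0" using pmf_eq_return_if_bilin_S_zero[of y] y assms(2) unfolding s_def by metis
  then have s: "0 < s" using bilin_nonneg(2)[of y] by (simp add: s_def)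
  define v where "v = one_shot_value A"
  define c0 where "c0 = (pure_minimax A - v) / s"
  have minimax: "pure_minimax A = v + c0 * s" using s by (simp add: c0_def)
  let ?cl = "c_lower A S" and ?cu = "c_upper A S" and ?G = "game_value A S"
  note lower = c_lower_properties[OF y min s[unfolded s_def], folded s_def v_def]
  note upper = c_upper_properties[unfolded minimax]
  have static: "static_value A S b \<le> v + b * s" "static_value A S b \<le> v + c0 * s" if "0 \<le> b" for b
    using static_value_le[OF that, of y] static_value_le_pure_minimax[OF that] y
    by (simp_all add: optimal_mixed_def v_def s_def minimax[symmetric, unfolded v_def s_def])
  have "v + ?cl * s \<le> v + c0 * s"
    using lower(2)[OF lower(1) order_refl] game_value_le_static_value[OF lower(1)] static(2)[OF lower(1)] by linarith
  then have cl: "?cl \<le> c0" using s by simp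
  have "v + c0 * s \<le> v + ?cu * s"
    using upper(2)[OF order_refl] game_value_le_static_value[OF upper(1)] static(1)[OF upper(1)] by linarith
  then have cu: "c0 \<le> ?cu" using s by simp
  have "static_value A S c - ?G c \<le> loss_bound ?cl ?cu c0 s c"
  proof (rule loss_bound_chord[OF cl cu _ c static[OF c]])
    assume between: "?cl < c" "c < ?cu"
    \<comment> \<open>Concavity of the value puts it above its chord between the two thresholds.\<close>
    define u where "u = (?cu - c) / (?cu - ?cl)"
    define w where "w = (c - ?cl) / (?cu - ?cl)"
    have uw: "0 \<le> u" "0 \<le> w" "u + w = 1" "u * ?cl + w * ?cu = c"
      using between by (simp_all add: u_def w_def divide_simps) (simp add: algebra_simps)
    have "u * (v + ?cl * s) + w * (v + c0 * s) \<le> u * ?G ?cl + w * ?G ?cu"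
      by (intro add_mono mult_left_mono lower upper uw order_refl)
    also have "\<dots> \<le> ?G c"
      using game_value_concave[OF lower(1) upper(1) uw(1-3)] unfolding uw(4) .
    finally show "(?cu - c) / (?cu - ?cl) * (v + ?cl * s) + (c - ?cl) / (?cu - ?cl) * (v + c0 * s) \<le> ?G c"
      by (simp only: u_def w_def)
  qed (use s c lower upper in auto)
  then show ?thesis by (simp add: Let_def s_def v_def c0_def)
qed

end
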